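(* There exists a morphism of simplicial sets which is an inner fibration and an isofibration on homotopy categories, but which is not a fibration in Joyal's model structure for quasi-categories.
   Context: A morphism of simplicial sets is an inner fibration if it has the right lifting property with respect to the inner horn inclusions $\Lambda^n_k \to \Delta^n$, $0<k<n$. The homotopy category functor $\mathrm{ho}$ from simplicial sets to categories is the left adjoint of the nerve functor. A morphism $p \colon X \to Y$ of simplicial sets is an isofibration on homotopy categories if the induced functor $\mathrm{ho}(p) \colon \mathrm{ho}(X) \to \mathrm{ho}(Y)$ is an isofibration, i.e. for every object $a$ of $\mathrm{ho}(X)$ and every isomorphism $v \colon \mathrm{ho}(p)(a) \to b$ in $\mathrm{ho}(Y)$ there is an isomorphism $u \colon a \to a'$ in $\mathrm{ho}(X)$ with $\mathrm{ho}(p)(u) = v$. A quasi-category is a simplicial set $X$ such that every morphism $\Lambda^n_k \to X$ with $0<k<n$ extends along $\Lambda^n_k \to \Delta^n$. Joyal's model structure for quasi-categories is the (unique) model structure on the category of simplicial sets whose cofibrations are the monomorphisms and whose fibrant objects are the quasi-categories. *)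

theory Defs
  imports Main "HOL-Library.FuncSet"
begin

section \<open>Simplicial sets\<close>

text \<open>
  The object \<open>[n]\<close> of the simplex category is \<open>{..n}\<close>. A simplicial set is a presheaf on the
  simplex category: \<open>act X m n \<alpha>\<close> is the map \<open>X n \<rightarrow> X m\<close> induced by \<open>\<alpha> : [m] \<rightarrow> [n]\<close>. Its
  values off the carrier are unspecified; those of a simplicial map are normalised
  (\<open>\<rightarrow>\<^sub>E\<close>), so that equality of simplicial maps is equality in HOL.
\<close>

definition delta_maps :: "nat \<Rightarrow> nat \<Rightarrow> (nat \<Rightarrow> nat) set" where
  "delta_maps m n = {\<alpha> \<in> {..m} \<rightarrow>\<^sub>E {..n}. mono_on {..m} \<alpha>}"

record 'a sset =
  simp :: "nat \<Rightarrow> 'a set"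
  act :: "nat \<Rightarrow> nat \<Rightarrow> (nat \<Rightarrow> nat) \<Rightarrow> 'a \<Rightarrow> 'a"

definition is_sset :: "'a sset \<Rightarrow> bool" where
  "is_sset X \<longleftrightarrow>
     (\<forall>m n. \<forall>\<alpha>\<in>delta_maps m n. \<forall>x\<in>simp X n. act X m n \<alpha> x \<in> simp X m) \<and>
     (\<forall>n. \<forall>x\<in>simp X n. act X n n (restrict id {..n}) x = x) \<and>
     (\<forall>l m n. \<forall>\<alpha>\<in>delta_maps m n. \<forall>\<beta>\<in>delta_maps l m. \<forall>x\<in>simp X n.
        act X l n (compose {..l} \<alpha> \<beta>) x = act X l m \<beta> (act X m n \<alpha> x))"

record ('a, 'b) smap =
  src :: "'a sset"
  tgt :: "'b sset"
  fn :: "nat \<Rightarrow> 'a \<Rightarrow> 'b"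

definition is_smap :: "('a, 'b) smap \<Rightarrow> bool" where
  "is_smap f \<longleftrightarrow> is_sset (src f) \<and> is_sset (tgt f) \<and>
     (\<forall>n. fn f n \<in> simp (src f) n \<rightarrow>\<^sub>E simp (tgt f) n) \<and>
     (\<forall>m n. \<forall>\<alpha>\<in>delta_maps m n. \<forall>x\<in>simp (src f) n.
        fn f m (act (src f) m n \<alpha> x) = act (tgt f) m n \<alpha> (fn f n x))"

definition scomp :: "('b, 'c) smap \<Rightarrow> ('a, 'b) smap \<Rightarrow> ('a, 'c) smap" where
  "scomp g f = \<lparr>src = src f, tgt = tgt g,
                fn = (\<lambda>n. compose (simp (src f) n) (fn g n) (fn f n))\<rparr>"

definition std_simplex :: "nat \<Rightarrow> (nat \<Rightarrow> nat) sset" where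
  "std_simplex n = \<lparr>simp = (\<lambda>m. delta_maps m n), act = (\<lambda>l m \<beta> \<alpha>. compose {..l} \<alpha> \<beta>)\<rparr>"

text \<open>The horn \<open>\<Lambda>\<^sup>n\<^sub>k\<close> is the union of the faces of the standard simplex opposite to the vertices
  \<open>j \<noteq> k\<close>, i.e. it consists of the simplices that miss some vertex \<open>j \<noteq> k\<close>.\<close>

definition horn :: "nat \<Rightarrow> nat \<Rightarrow> (nat \<Rightarrow> nat) sset" where
  "horn n k = (std_simplex n)
     \<lparr>simp := \<lambda>m. {\<alpha> \<in> delta_maps m n. \<exists>j\<le>n. j \<noteq> k \<and> j \<notin> \<alpha> ` {..m}}\<rparr>"

definition horn_inclusion :: "nat \<Rightarrow> nat \<Rightarrow> (nat \<Rightarrow> nat, nat \<Rightarrow> nat) smap" where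
  "horn_inclusion n k = \<lparr>src = horn n k, tgt = std_simplex n,
                         fn = (\<lambda>m. restrict id (simp (horn n k) m))\<rparr>"

definition has_lifting :: "('a, 'b) smap \<Rightarrow> ('c, 'd) smap \<Rightarrow> bool" where
  "has_lifting i p \<longleftrightarrow>
     (\<forall>u v. is_smap u \<and> src u = src i \<and> tgt u = src p \<and>
            is_smap v \<and> src v = tgt i \<and> tgt v = tgt p \<and> scomp p u = scomp v i \<longrightarrow>
        (\<exists>h. is_smap h \<and> src h = tgt i \<and> tgt h = src p \<and> scomp h i = u \<and> scomp p h = v))"

definition inner_fibration :: "('a, 'b) smap \<Rightarrow> bool" where
  "inner_fibration p \<longleftrightarrow>
     is_smap p \<and> (\<forall>n k. 0 < k \<and> k < n \<longrightarrow> has_lifting (horn_inclusion n k) p)"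

definition quasi_category :: "'a sset \<Rightarrow> bool" where
  "quasi_category X \<longleftrightarrow> is_sset X \<and>
     (\<forall>n k. 0 < k \<and> k < n \<longrightarrow>
        (\<forall>u. is_smap u \<and> src u = horn n k \<and> tgt u = X \<longrightarrow>
           (\<exists>h. is_smap h \<and> src h = std_simplex n \<and> tgt h = X \<and>
                scomp h (horn_inclusion n k) = u)))"


section \<open>Categories, nerves and homotopy categories\<close>

record ('o, 'm) cat =
  Obj :: "'o set"
  Arr :: "'m set"
  Dom :: "'m \<Rightarrow> 'o"
  Cod :: "'m \<Rightarrow> 'o"
  Ident :: "'o \<Rightarrow> 'm"
  Comp :: "'m \<Rightarrow> 'm \<Rightarrow> 'm"

definition is_category :: "('o, 'm) cat \<Rightarrow> bool" where
  "is_category C \<longleftrightarrow>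
     (\<forall>f\<in>Arr C. Dom C f \<in> Obj C \<and> Cod C f \<in> Obj C) \<and>
     (\<forall>a\<in>Obj C. Ident C a \<in> Arr C \<and> Dom C (Ident C a) = a \<and> Cod C (Ident C a) = a) \<and>
     (\<forall>f\<in>Arr C. \<forall>g\<in>Arr C. Cod C f = Dom C g \<longrightarrow>
        Comp C g f \<in> Arr C \<and> Dom C (Comp C g f) = Dom C f \<and> Cod C (Comp C g f) = Cod C g) \<and>
     (\<forall>f\<in>Arr C. Comp C f (Ident C (Dom C f)) = f \<and> Comp C (Ident C (Cod C f)) f = f) \<and>
     (\<forall>f\<in>Arr C. \<forall>g\<in>Arr C. \<forall>h\<in>Arr C. Cod C f = Dom C g \<and> Cod C g = Dom C h \<longrightarrow>
        Comp C h (Comp C g f) = Comp C (Comp C h g) f)"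

definition is_iso :: "('o, 'm) cat \<Rightarrow> 'm \<Rightarrow> bool" where
  "is_iso C f \<longleftrightarrow> f \<in> Arr C \<and>
     (\<exists>g\<in>Arr C. Dom C g = Cod C f \<and> Cod C g = Dom C f \<and>
        Comp C g f = Ident C (Dom C f) \<and> Comp C f g = Ident C (Cod C f))"

record ('o, 'm, 'p, 'n) fctr =
  fobj :: "'o \<Rightarrow> 'p"
  farr :: "'m \<Rightarrow> 'n"

definition is_functor ::
    "('o, 'm) cat \<Rightarrow> ('p, 'n) cat \<Rightarrow> ('o, 'm, 'p, 'n) fctr \<Rightarrow> bool" where
  "is_functor C D F \<longleftrightarrow> is_category C \<and> is_category D \<and>
     fobj F \<in> Obj C \<rightarrow>\<^sub>E Obj D \<and> farr F \<in> Arr C \<rightarrow>\<^sub>E Arr D \<and>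
     (\<forall>f\<in>Arr C. Dom D (farr F f) = fobj F (Dom C f) \<and> Cod D (farr F f) = fobj F (Cod C f)) \<and>
     (\<forall>a\<in>Obj C. farr F (Ident C a) = Ident D (fobj F a)) \<and>
     (\<forall>f\<in>Arr C. \<forall>g\<in>Arr C. Cod C f = Dom C g \<longrightarrow>
        farr F (Comp C g f) = Comp D (farr F g) (farr F f))"

definition fctr_comp ::
    "('o, 'm) cat \<Rightarrow> ('p, 'n, 'q, 'l) fctr \<Rightarrow> ('o, 'm, 'p, 'n) fctr \<Rightarrow> ('o, 'm, 'q, 'l) fctr" where
  "fctr_comp C G F =
     \<lparr>fobj = compose (Obj C) (fobj G) (fobj F), farr = compose (Arr C) (farr G) (farr F)\<rparr>"

definition isofibration ::
    "('o, 'm) cat \<Rightarrow> ('p, 'n) cat \<Rightarrow> ('o, 'm, 'p, 'n) fctr \<Rightarrow> bool" where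
  "isofibration C D F \<longleftrightarrow> is_functor C D F \<and>
     (\<forall>a\<in>Obj C. \<forall>v. is_iso D v \<and> Dom D v = fobj F a \<longrightarrow>
        (\<exists>u. is_iso C u \<and> Dom C u = a \<and> farr F u = v))"

text \<open>The poset \<open>[n]\<close> as a category; the pair \<open>(i, j)\<close> is the arrow \<open>i \<rightarrow> j\<close>.\<close>

definition ordinal_cat :: "nat \<Rightarrow> (nat, nat \<times> nat) cat" where
  "ordinal_cat n = \<lparr>Obj = {..n}, Arr = {(i, j). i \<le> j \<and> j \<le> n}, Dom = fst, Cod = snd,
                    Ident = (\<lambda>i. (i, i)), Comp = (\<lambda>g f. (fst f, snd g))\<rparr>"

definition ordinal_functor :: "nat \<Rightarrow> (nat \<Rightarrow> nat) \<Rightarrow> (nat, nat \<times> nat, nat, nat \<times> nat) fctr" where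
  "ordinal_functor m \<alpha> = \<lparr>fobj = restrict \<alpha> {..m},
                          farr = restrict (map_prod \<alpha> \<alpha>) (Arr (ordinal_cat m))\<rparr>"

definition nerve :: "('o, 'm) cat \<Rightarrow> (nat, nat \<times> nat, 'o, 'm) fctr sset" where
  "nerve C = \<lparr>simp = (\<lambda>n. {\<sigma>. is_functor (ordinal_cat n) C \<sigma>}),
              act = (\<lambda>m n \<alpha> \<sigma>. fctr_comp (ordinal_cat m) \<sigma> (ordinal_functor m \<alpha>))\<rparr>"

definition nerve_map ::
    "('o, 'm) cat \<Rightarrow> ('p, 'n) cat \<Rightarrow> ('o, 'm, 'p, 'n) fctr \<Rightarrow>
     ((nat, nat \<times> nat, 'o, 'm) fctr, (nat, nat \<times> nat, 'p, 'n) fctr) smap" where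
  "nerve_map C D F = \<lparr>src = nerve C, tgt = nerve D,
     fn = (\<lambda>n. restrict (\<lambda>\<sigma>. fctr_comp (ordinal_cat n) F \<sigma>) (simp (nerve C) n))\<rparr>"

text \<open>
  \<open>(C, \<eta>)\<close> is the value at \<open>X\<close> of the left adjoint of the nerve functor, with the unit
  \<open>\<eta> : X \<rightarrow> nerve C\<close> of the adjunction. The type \<open>'u\<close> plays the role of a universe: simplicial
  sets and categories have their simplices, objects and arrows in \<open>'u\<close>. When \<open>'u\<close> is infinite,
  the homotopy category of a simplicial set over \<open>'u\<close> again fits into \<open>'u\<close>.
\<close>

definition homotopy_category ::
    "'u sset \<Rightarrow> ('u, 'u) cat \<Rightarrow> ('u, (nat, nat \<times> nat, 'u, 'u) fctr) smap \<Rightarrow> bool" where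
  "homotopy_category X C \<eta> \<longleftrightarrow>
     is_category C \<and> is_smap \<eta> \<and> src \<eta> = X \<and> tgt \<eta> = nerve C \<and>
     (\<forall>(D :: ('u, 'u) cat) g. is_category D \<and> is_smap g \<and> src g = X \<and> tgt g = nerve D \<longrightarrow>
        (\<exists>!F. is_functor C D F \<and> scomp (nerve_map C D F) \<eta> = g))"

text \<open>The functor \<open>F\<close> below is \<open>ho(p)\<close>: it is determined by naturality of the unit. Homotopy
  categories being unique up to unique isomorphism, the choice of \<open>C\<close> and \<open>D\<close> does not matter.\<close>

definition isofibration_on_ho :: "('u, 'u) smap \<Rightarrow> bool" where
  "isofibration_on_ho p \<longleftrightarrow> is_smap p \<and>
     (\<exists>C \<eta> D \<theta> F. homotopy_category (src p) C \<eta> \<and> homotopy_category (tgt p) D \<theta> \<and>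
        is_functor C D F \<and> scomp (nerve_map C D F) \<eta> = scomp \<theta> p \<and> isofibration C D F)"


section \<open>Joyal's model structure\<close>

text \<open>
  The category of simplicial sets is that of simplicial sets with simplices in the universe
  type \<open>'u\<close>, and classes of morphisms are sets of type \<open>('u, 'u) smap set\<close>.
\<close>

definition weak_factorisation_system ::
    "('u, 'u) smap set \<Rightarrow> ('u, 'u) smap set \<Rightarrow> bool" where
  "weak_factorisation_system L R \<longleftrightarrow>
     L = {i. is_smap i \<and> (\<forall>p\<in>R. has_lifting i p)} \<and>
     R = {p. is_smap p \<and> (\<forall>i\<in>L. has_lifting i p)} \<and>
     (\<forall>f. is_smap f \<longrightarrow> (\<exists>i\<in>L. \<exists>p\<in>R. tgt i = src p \<and> f = scomp p i))"

definition two_out_of_three :: "('u, 'u) smap set \<Rightarrow> bool" where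
  "two_out_of_three W \<longleftrightarrow>
     (\<forall>f g. is_smap f \<and> is_smap g \<and> tgt f = src g \<longrightarrow>
        (f \<in> W \<and> g \<in> W \<longrightarrow> scomp g f \<in> W) \<and>
        (f \<in> W \<and> scomp g f \<in> W \<longrightarrow> g \<in> W) \<and>
        (g \<in> W \<and> scomp g f \<in> W \<longrightarrow> f \<in> W))"

text \<open>\<open>W\<close>, \<open>C\<close> and \<open>F\<close> are the weak equivalences, cofibrations and fibrations. Closure of all three
  under retracts follows from these axioms.\<close>

definition model_structure ::
    "('u, 'u) smap set \<Rightarrow> ('u, 'u) smap set \<Rightarrow> ('u, 'u) smap set \<Rightarrow> bool" where
  "model_structure W C F \<longleftrightarrow> W \<subseteq> {f. is_smap f} \<and> two_out_of_three W \<and>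
     weak_factorisation_system (C \<inter> W) F \<and> weak_factorisation_system C (F \<inter> W)"

definition monomorphism :: "('u, 'u) smap \<Rightarrow> bool" where
  "monomorphism f \<longleftrightarrow> is_smap f \<and>
     (\<forall>g h :: ('u, 'u) smap. is_smap g \<and> is_smap h \<and> src g = src h \<and>
        tgt g = src f \<and> tgt h = src f \<and> scomp f g = scomp f h \<longrightarrow> g = h)"

definition terminal_sset :: "'u sset \<Rightarrow> bool" where
  "terminal_sset T \<longleftrightarrow> is_sset T \<and>
     (\<forall>X :: 'u sset. is_sset X \<longrightarrow> (\<exists>!f. is_smap f \<and> src f = X \<and> tgt f = T))"

definition fibrant :: "('u, 'u) smap set \<Rightarrow> 'u sset \<Rightarrow> bool" where
  "fibrant F X \<longleftrightarrow> (\<exists>f\<in>F. src f = X \<and> terminal_sset (tgt f))"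

text \<open>These conditions determine \<open>W\<close>, \<open>C\<close> and \<open>F\<close> uniquely. That \<open>p\<close> is not a fibration in Joyal's
  model structure is expressed as: \<open>p \<notin> F\<close> for every \<open>W\<close>, \<open>C\<close>, \<open>F\<close> satisfying them.\<close>

definition joyal_model_structure ::
    "('u, 'u) smap set \<Rightarrow> ('u, 'u) smap set \<Rightarrow> ('u, 'u) smap set \<Rightarrow> bool" where
  "joyal_model_structure W C F \<longleftrightarrow> model_structure W C F \<and>
     C = {f. monomorphism f} \<and> (\<forall>X. is_sset X \<longrightarrow> (fibrant F X \<longleftrightarrow> quasi_category X))"

end

theory Submission
  imports Defs "HOL-Library.Countable_Set"
begin

text \<open>
  The counterexample is the inclusion \<open>p : \<Delta>\<^sup>1 \<rightarrow> T\<close> of an edge into a triangle \<open>T = \<Delta>\<^sup>2 / \<Delta>\<^bsup>{0,1}\<^esup>\<close>,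
  whose edge \<open>01\<close> has been collapsed to a point. What remains is a pair of parallel edges \<open>02\<close> and
  \<open>12\<close>, joined by the triangle, and \<open>p\<close> (\<open>long_edge\<close>) is the inclusion of \<open>02\<close>.

  Let \<open>W\<close>, \<open>C\<close>, \<open>F\<close> be Joyal's model structure. The inclusion of the other edge \<open>12\<close>
  (\<open>short_edge\<close>) is a pushout of the inner horn \<open>\<Lambda>\<^sup>2\<^sub>1 \<rightarrow> \<Delta>\<^sup>2\<close>: an edge \<open>12\<close> together with a degenerate
  edge \<open>01\<close> is such a horn. So it is an acyclic cofibration once that horn is. The
  two inclusions have a common retraction \<open>T \<rightarrow> \<Delta>\<^sup>1\<close>. By two-out-of-three, first the retraction and
  then \<open>p\<close> lie in \<open>W\<close>. Being a split monomorphism, \<open>p\<close> is thus an acyclic cofibration. If \<open>p\<close> were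
  also a fibration, it would lift against itself and so be an isomorphism, but the edge \<open>12\<close> is
  not in its image (\<open>long_edge_not_joyal_fibration\<close>).

  That inner horn inclusions are acyclic cofibrations follows from the description of the
  fibrant objects by a retract argument (\<open>joyal_fibration_lifts_horn\<close>). Factor
  \<open>\<Lambda>\<^sup>n\<^sub>k \<rightarrow> \<Delta>\<^sup>n\<close> as an acyclic cofibration \<open>j\<close> into some \<open>Q\<close> followed by a fibration \<open>Q \<rightarrow> \<Delta>\<^sup>n\<close>. Since
  \<open>\<Delta>\<^sup>n\<close> is a quasi-category, so is \<open>Q\<close>, and hence \<open>j\<close> extends to \<open>\<Delta>\<^sup>n \<rightarrow> Q\<close>. The composite
  \<open>\<Delta>\<^sup>n \<rightarrow> Q \<rightarrow> \<Delta>\<^sup>n\<close> fixes the vertices and so is the identity, which makes the horn inclusion a retract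
  of \<open>j\<close>.

  On the other hand, \<open>p\<close> is an inner fibration (\<open>long_edge_lifts_inner_horns\<close>): a simplex of \<open>T\<close>
  outside the image of \<open>p\<close> has two consecutive vertices that span the edge \<open>12\<close>, and this edge already
  belongs to every inner horn. Finally, \<open>ho(p)\<close> is an isomorphism: in a category, the
  triangle forces the arrows \<open>02\<close> and \<open>12\<close> to be equal, so that maps from \<open>T\<close> to a nerve are
  determined by the edge \<open>02\<close> (\<open>nerve_smap_long_edge_retraction\<close>), and both homotopy categories are
  the ordinal \<open>[1]\<close> (\<open>isofibration_on_ho_long_edge\<close>).
\<close>

section \<open>Simplicial maps\<close>

definition mk_smap :: "'a sset \<Rightarrow> 'b sset \<Rightarrow> (nat \<Rightarrow> 'a \<Rightarrow> 'b) \<Rightarrow> ('a, 'b) smap" where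
  "mk_smap X Y \<phi> = \<lparr>src = X, tgt = Y, fn = (\<lambda>n. restrict (\<phi> n) (simp X n))\<rparr>"

lemma mk_smap_sel [simp]:
  "src (mk_smap X Y \<phi>) = X" "tgt (mk_smap X Y \<phi>) = Y"
  "x \<in> simp X n \<Longrightarrow> fn (mk_smap X Y \<phi>) n x = \<phi> n x"
  by (simp_all add: mk_smap_def)

lemma scomp_sel [simp]:
  "src (scomp g f) = src f" "tgt (scomp g f) = tgt g"
  "x \<in> simp (src f) n \<Longrightarrow> fn (scomp g f) n x = fn g n (fn f n x)"
  by (simp_all add: scomp_def compose_def)

lemma is_smap_mk_smap:
  assumes "is_sset X" "is_sset Y"
    and "\<And>n x. x \<in> simp X n \<Longrightarrow> \<phi> n x \<in> simp Y n"
    and "\<And>m n \<alpha> x. \<alpha> \<in> delta_maps m n \<Longrightarrow> x \<in> simp X n \<Longrightarrow>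
           \<phi> m (act X m n \<alpha> x) = act Y m n \<alpha> (\<phi> n x)"
  shows "is_smap (mk_smap X Y \<phi>)"
  unfolding is_smap_def
proof (intro conjI allI ballI)
  fix m n \<alpha> x assume "\<alpha> \<in> delta_maps m n" "x \<in> simp (src (mk_smap X Y \<phi>)) n"
  moreover from this have "act X m n \<alpha> x \<in> simp X m"
    using assms(1) by (simp add: is_sset_def)
  ultimately show "fn (mk_smap X Y \<phi>) m (act (src (mk_smap X Y \<phi>)) m n \<alpha> x)
      = act (tgt (mk_smap X Y \<phi>)) m n \<alpha> (fn (mk_smap X Y \<phi>) n x)"
    using assms(4) by simp
qed (use assms in \<open>auto simp: mk_smap_def\<close>)

lemma is_ssetI:
  assumes "\<And>m n \<alpha> x. \<alpha> \<in> delta_maps m n \<Longrightarrow> x \<in> simp X n \<Longrightarrow> act X m n \<alpha> x \<in> simp X m"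
    and "\<And>n x. x \<in> simp X n \<Longrightarrow> act X n n (restrict id {..n}) x = x"
    and "\<And>l m n \<alpha> \<beta> x. \<alpha> \<in> delta_maps m n \<Longrightarrow> \<beta> \<in> delta_maps l m \<Longrightarrow> x \<in> simp X n \<Longrightarrow>
           act X l n (compose {..l} \<alpha> \<beta>) x = act X l m \<beta> (act X m n \<alpha> x)"
  shows "is_sset X"
  unfolding is_sset_def using assms by blast

lemma act_in: "is_sset X \<Longrightarrow> \<alpha> \<in> delta_maps m n \<Longrightarrow> x \<in> simp X n \<Longrightarrow> act X m n \<alpha> x \<in> simp X m"
  by (simp add: is_sset_def)

lemma act_act:
  "is_sset X \<Longrightarrow> \<alpha> \<in> delta_maps m n \<Longrightarrow> \<beta> \<in> delta_maps l m \<Longrightarrow> x \<in> simp X n \<Longrightarrow>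
   act X l m \<beta> (act X m n \<alpha> x) = act X l n (compose {..l} \<alpha> \<beta>) x"
  by (simp add: is_sset_def)

lemma act_id: "is_sset X \<Longrightarrow> x \<in> simp X n \<Longrightarrow> act X n n (restrict id {..n}) x = x"
  by (simp add: is_sset_def)

lemma smap_in: "is_smap f \<Longrightarrow> x \<in> simp (src f) n \<Longrightarrow> fn f n x \<in> simp (tgt f) n"
  by (auto simp: is_smap_def)

lemma smap_act:
  "is_smap f \<Longrightarrow> \<alpha> \<in> delta_maps m n \<Longrightarrow> x \<in> simp (src f) n \<Longrightarrow>
   fn f m (act (src f) m n \<alpha> x) = act (tgt f) m n \<alpha> (fn f n x)"
  by (simp add: is_smap_def)

lemma smap_sset: "is_smap f \<Longrightarrow> is_sset (src f)" "is_smap f \<Longrightarrow> is_sset (tgt f)"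
  by (simp_all add: is_smap_def)

lemma smap_ext: "is_smap f \<Longrightarrow> fn f n \<in> extensional (simp (src f) n)"
  unfolding is_smap_def PiE_def by blast

lemma scomp_ext: "fn (scomp g f) n \<in> extensional (simp (src f) n)"
  by (simp add: scomp_def)

lemma smap_eqI:
  fixes f g :: "('a, 'b) smap"
  assumes "src f = src g" "tgt f = tgt g"
    and "\<And>n. fn f n \<in> extensional (simp (src f) n)" "\<And>n. fn g n \<in> extensional (simp (src g) n)"
    and "\<And>n x. x \<in> simp (src f) n \<Longrightarrow> fn f n x = fn g n x"
  shows "f = g"
proof -
  have "fn f = fn g"
    using assms by (metis ext extensionalityI)
  with assms(1,2) show ?thesis
    by (cases f, cases g) simp
qed

lemma is_smap_scomp:
  assumes "is_smap f" "is_smap g" "tgt f = src g"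
  shows "is_smap (scomp g f)"
  unfolding is_smap_def
proof (intro conjI allI ballI)
  fix m n \<alpha> x assume "\<alpha> \<in> delta_maps m n" "x \<in> simp (src (scomp g f)) n"
  then show "fn (scomp g f) m (act (src (scomp g f)) m n \<alpha> x)
      = act (tgt (scomp g f)) m n \<alpha> (fn (scomp g f) n x)"
    using assms smap_in[of f x n]
    by (simp add: act_in smap_sset smap_act)
next
  fix n
  show "fn (scomp g f) n \<in> simp (src (scomp g f)) n \<rightarrow>\<^sub>E simp (tgt (scomp g f)) n"
    using assms smap_in[of f _ n] smap_in[of g _ n] scomp_ext[of g f n]
    by (auto simp: PiE_def)
qed (use assms in \<open>auto simp: smap_sset\<close>)

lemma scomp_assoc:
  assumes "is_smap f" "tgt f = src g"
  shows "scomp h (scomp g f) = scomp (scomp h g) f"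
proof (rule smap_eqI)
  show "fn (scomp h (scomp g f)) n \<in> extensional (simp (src (scomp h (scomp g f))) n)"
    "fn (scomp (scomp h g) f) n \<in> extensional (simp (src (scomp (scomp h g) f)) n)" for n
    by (simp_all add: scomp_def)
qed (use assms smap_in[of f] in auto)

definition smap_id :: "'a sset \<Rightarrow> ('a, 'a) smap" where
  "smap_id X = mk_smap X X (\<lambda>n x. x)"

lemma smap_id_sel [simp]:
  "src (smap_id X) = X" "tgt (smap_id X) = X" "x \<in> simp X n \<Longrightarrow> fn (smap_id X) n x = x"
  by (simp_all add: smap_id_def)

lemma is_smap_id: "is_sset X \<Longrightarrow> is_smap (smap_id X)"
  unfolding smap_id_def by (rule is_smap_mk_smap) auto

lemma scomp_id_right: "is_smap f \<Longrightarrow> src f = X \<Longrightarrow> scomp f (smap_id X) = f"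
  by (rule smap_eqI) (use scomp_ext[of f "smap_id X"] in \<open>auto simp: smap_ext\<close>)

lemma scomp_id_left: "is_smap f \<Longrightarrow> tgt f = X \<Longrightarrow> scomp (smap_id X) f = f"
  by (rule smap_eqI) (use scomp_ext[of "smap_id X" f] in \<open>auto simp: smap_ext smap_in\<close>)

section \<open>Standard simplices and horns\<close>

lemma delta_mapsI:
  assumes "\<And>i. i \<le> m \<Longrightarrow> \<alpha> i \<le> n" "\<And>i j. i \<le> j \<Longrightarrow> j \<le> m \<Longrightarrow> \<alpha> i \<le> \<alpha> j" "\<alpha> \<in> extensional {..m}"
  shows "\<alpha> \<in> delta_maps m n"
  using assms by (auto simp: delta_maps_def mono_on_def PiE_def)

lemma delta_mapsD:
  assumes "\<alpha> \<in> delta_maps m n"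
  shows "i \<le> m \<Longrightarrow> \<alpha> i \<le> n" "i \<le> j \<Longrightarrow> j \<le> m \<Longrightarrow> \<alpha> i \<le> \<alpha> j" "\<alpha> \<in> extensional {..m}"
  using assms by (auto simp: delta_maps_def mono_on_def PiE_def)

lemma restrict_delta_maps:
  "(\<And>i. i \<le> m \<Longrightarrow> \<phi> i \<le> n) \<Longrightarrow> (\<And>i j. i \<le> j \<Longrightarrow> j \<le> m \<Longrightarrow> \<phi> i \<le> \<phi> j) \<Longrightarrow>
   restrict \<phi> {..m} \<in> delta_maps m n"
  by (rule delta_mapsI) auto

lemma compose_atMost [simp]: "i \<le> m \<Longrightarrow> compose {..m} \<beta> \<alpha> i = \<beta> (\<alpha> i)"
  by (simp add: compose_def)

lemma compose_delta_maps:
  "\<alpha> \<in> delta_maps l m \<Longrightarrow> (\<And>i. i \<le> m \<Longrightarrow> \<phi> i \<le> n) \<Longrightarrow>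
   (\<And>i j. i \<le> j \<Longrightarrow> j \<le> m \<Longrightarrow> \<phi> i \<le> \<phi> j) \<Longrightarrow> compose {..l} \<phi> \<alpha> \<in> delta_maps l n"
  by (rule delta_mapsI) (use delta_mapsD(1,2)[of \<alpha> l m] in auto)

lemma delta_maps_compose:
  "\<beta> \<in> delta_maps m n \<Longrightarrow> \<alpha> \<in> delta_maps l m \<Longrightarrow> compose {..l} \<beta> \<alpha> \<in> delta_maps l n"
  by (rule compose_delta_maps) (use delta_mapsD(1,2)[of \<beta> m n] in auto)

lemma id_delta_maps: "restrict id {..n} \<in> delta_maps n n"
  by (rule restrict_delta_maps) auto

lemma delta_maps_ext:
  assumes "\<alpha> \<in> extensional {..m}" "\<beta> \<in> extensional {..m}" "\<And>i. i \<le> m \<Longrightarrow> \<alpha> i = \<beta> i"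
  shows "\<alpha> = \<beta>"
  by (rule extensionalityI[OF assms(1,2)]) (use assms(3) in auto)

lemma compose_id_delta: "\<alpha> \<in> delta_maps m n \<Longrightarrow> compose {..m} \<alpha> (restrict id {..m}) = \<alpha>"
  by (rule delta_maps_ext[where m = m]) (auto simp: delta_mapsD(3))

lemma id_compose_delta: "\<alpha> \<in> delta_maps m n \<Longrightarrow> compose {..m} (restrict id {..n}) \<alpha> = \<alpha>"
  by (rule delta_maps_ext[where m = m]) (simp_all add: delta_mapsD(1)[of \<alpha> m n] delta_mapsD(3))

lemma compose_assoc_delta:
  "\<beta> \<in> delta_maps l m \<Longrightarrow> compose {..l} (compose {..m} \<gamma> \<alpha>) \<beta> = compose {..l} \<gamma> (compose {..l} \<alpha> \<beta>)"
  by (rule delta_maps_ext[where m = l]) (simp_all add: delta_mapsD(1)[of \<beta> l m])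

lemma simplex_sel [simp]:
  "simp (std_simplex n) m = delta_maps m n" "act (std_simplex n) l m \<beta> \<alpha> = compose {..l} \<alpha> \<beta>"
  by (simp_all add: std_simplex_def)

lemma horn_sel [simp]:
  "simp (horn n k) m = {\<alpha> \<in> delta_maps m n. \<exists>j\<le>n. j \<noteq> k \<and> j \<notin> \<alpha> ` {..m}}"
  "act (horn n k) l m \<beta> \<alpha> = compose {..l} \<alpha> \<beta>"
  by (simp_all add: horn_def std_simplex_def)

lemma is_sset_simplex: "is_sset (std_simplex n)"
proof (rule is_ssetI)
  show "act (std_simplex n) m k \<alpha> x \<in> simp (std_simplex n) m"
    if "\<alpha> \<in> delta_maps m k" "x \<in> simp (std_simplex n) k" for m k \<alpha> x
    using that by (simp add: delta_maps_compose)
qed (simp_all add: compose_id_delta compose_assoc_delta)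

lemma is_sset_horn: "is_sset (horn n k)"
proof (rule is_ssetI)
  fix m q \<alpha> x assume \<alpha>: "\<alpha> \<in> delta_maps m q" and x: "x \<in> simp (horn n k) q"
  from x obtain j where j: "j \<le> n" "j \<noteq> k" "j \<notin> x ` {..q}"
    by auto
  have "j \<notin> compose {..m} x \<alpha> ` {..m}"
    using j(3) delta_mapsD(1)[OF \<alpha>] by (force simp: image_iff)
  then show "act (horn n k) m q \<alpha> x \<in> simp (horn n k) m"
    using j \<alpha> x delta_maps_compose[of x q n \<alpha> m] by auto
qed (auto simp: compose_id_delta compose_assoc_delta)

lemma horn_inclusion_mk: "horn_inclusion n k = mk_smap (horn n k) (std_simplex n) (\<lambda>m x. x)"
  by (simp add: horn_inclusion_def mk_smap_def id_def)

lemma horn_inclusion_sel [simp]: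
  "src (horn_inclusion n k) = horn n k" "tgt (horn_inclusion n k) = std_simplex n"
  "x \<in> simp (horn n k) m \<Longrightarrow> fn (horn_inclusion n k) m x = x"
  by (simp_all add: horn_inclusion_mk del: horn_sel)

lemma is_smap_horn_inclusion: "is_smap (horn_inclusion n k)"
  unfolding horn_inclusion_mk by (rule is_smap_mk_smap) (auto intro: is_sset_simplex is_sset_horn)

definition simplex_map :: "nat \<Rightarrow> nat \<Rightarrow> (nat \<Rightarrow> nat) \<Rightarrow> (nat \<Rightarrow> nat, nat \<Rightarrow> nat) smap" where
  "simplex_map a b \<phi> = mk_smap (std_simplex a) (std_simplex b) (\<lambda>m. compose {..m} \<phi>)"

lemma simplex_map_sel [simp]:
  "src (simplex_map a b \<phi>) = std_simplex a" "tgt (simplex_map a b \<phi>) = std_simplex b"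
  "\<alpha> \<in> delta_maps m a \<Longrightarrow> fn (simplex_map a b \<phi>) m \<alpha> = compose {..m} \<phi> \<alpha>"
  by (simp_all add: simplex_map_def)

lemma is_smap_simplex_map:
  assumes "\<And>i. i \<le> a \<Longrightarrow> \<phi> i \<le> b" "\<And>i j. i \<le> j \<Longrightarrow> j \<le> a \<Longrightarrow> \<phi> i \<le> \<phi> j"
  shows "is_smap (simplex_map a b \<phi>)"
  unfolding simplex_map_def
proof (rule is_smap_mk_smap)
  fix m n \<alpha> x assume "\<alpha> \<in> delta_maps m n" "x \<in> simp (std_simplex a) n"
  then show "compose {..m} \<phi> (act (std_simplex a) m n \<alpha> x)
      = act (std_simplex b) m n \<alpha> (compose {..n} \<phi> x)"
    by (simp add: compose_assoc_delta)
qed (use assms in \<open>auto simp: is_sset_simplex intro: compose_delta_maps\<close>)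

definition yoneda_map :: "'a sset \<Rightarrow> nat \<Rightarrow> 'a \<Rightarrow> (nat \<Rightarrow> nat, 'a) smap" where
  "yoneda_map X n x = mk_smap (std_simplex n) X (\<lambda>m \<alpha>. act X m n \<alpha> x)"

lemma yoneda_map_sel [simp]:
  "src (yoneda_map X n x) = std_simplex n" "tgt (yoneda_map X n x) = X"
  "\<alpha> \<in> delta_maps m n \<Longrightarrow> fn (yoneda_map X n x) m \<alpha> = act X m n \<alpha> x"
  by (simp_all add: yoneda_map_def)

lemma is_smap_yoneda_map: "is_sset X \<Longrightarrow> x \<in> simp X n \<Longrightarrow> is_smap (yoneda_map X n x)"
  unfolding yoneda_map_def
  by (rule is_smap_mk_smap) (auto simp: is_sset_simplex act_in act_act)

lemma smap_from_simplex:
  assumes "is_smap v" "src v = std_simplex n" "\<alpha> \<in> delta_maps m n"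
  shows "fn v m \<alpha> = act (tgt v) m n \<alpha> (fn v n (restrict id {..n}))"
  using smap_act[OF assms(1,3), of "restrict id {..n}"] assms
  by (simp add: id_delta_maps id_compose_delta)

definition vertex :: "nat \<Rightarrow> nat \<Rightarrow> nat" where
  "vertex i = (\<lambda>_\<in>{0}. i)"

definition edge :: "nat \<Rightarrow> nat \<Rightarrow> nat \<Rightarrow> nat" where
  "edge i j = (\<lambda>s\<in>{..1}. if s = 0 then i else j)"

lemma edge_app [simp]: "edge i j 0 = i" "edge i j (Suc 0) = j"
  by (simp_all add: edge_def)

lemma vertex_delta_maps: "i \<le> n \<Longrightarrow> vertex i \<in> delta_maps 0 n"
  using restrict_delta_maps[of 0 "\<lambda>_. i" n] by (simp add: vertex_def)

lemma edge_delta_maps: "i \<le> j \<Longrightarrow> j \<le> n \<Longrightarrow> edge i j \<in> delta_maps 1 n"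
  unfolding edge_def by (rule restrict_delta_maps) auto

lemma vertex_in_horn:
  assumes "2 \<le> n" "i \<le> n"
  shows "vertex i \<in> simp (horn n k) 0"
proof -
  have "card {i, k} < card {..n}"
    using assms(1) by (simp add: card_insert_if)
  then obtain j where "j \<in> {..n}" "j \<notin> {i, k}"
    by (metis card_mono finite.emptyI finite.insertI leD subsetI)
  then show ?thesis
    using vertex_delta_maps[OF assms(2)] by (auto simp: vertex_def)
qed

lemma edge_in_inner_horn:
  assumes "0 < k" "k < n" "t < n"
  shows "edge t (Suc t) \<in> simp (horn n k) 1"
proof -
  have "\<exists>j\<le>n. j \<noteq> k \<and> j \<notin> edge t (Suc t) ` {..1}"
  proof (cases "Suc t < n")
    case True
    then show ?thesis using assms by (intro exI[of _ n]) (auto simp: edge_def)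
  next
    case False
    then show ?thesis using assms by (intro exI[of _ 0]) (auto simp: edge_def)
  qed
  then show ?thesis
    using edge_delta_maps[of t "Suc t" n] assms by simp
qed

text \<open>
  A simplex of \<open>\<Delta>\<^sup>N\<close> is the sequence of its vertices, so a map to \<open>\<Delta>\<^sup>N\<close> can be read off from its values
  on vertices.
\<close>

lemma smap_to_simplex_app:
  assumes "is_smap u" "tgt u = std_simplex N" "x \<in> simp (src u) m" "t \<le> m"
  shows "fn u m x t = fn u 0 (act (src u) 0 m (vertex t) x) 0"
  using smap_act[OF assms(1) vertex_delta_maps[OF assms(4)] assms(3)] assms(2)
  by (simp add: vertex_def compose_def)

lemma compose_vertex: "compose {0} \<alpha> (vertex t) = vertex (\<alpha> t)"
  by (auto simp: vertex_def compose_def)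

text \<open>
  For \<open>n \<ge> 2\<close> a horn contains all vertices of \<open>\<Delta>\<^sup>n\<close>, and these determine the map.
\<close>

lemma simplex_smap_eqI:
  assumes "is_smap f" "is_smap g" "src f = std_simplex n" "src g = std_simplex n"
    and "tgt f = std_simplex N" "tgt g = std_simplex N" and n: "2 \<le> n"
    and eq: "scomp f (horn_inclusion n k) = scomp g (horn_inclusion n k)"
  shows "f = g"
proof (rule smap_eqI)
  fix m \<alpha> assume "\<alpha> \<in> simp (src f) m"
  then have \<alpha>: "\<alpha> \<in> delta_maps m n"
    using assms(3) by simp
  have *: "fn f 0 (vertex i) = fn g 0 (vertex i)" if "i \<le> n" for i
    using arg_cong[OF eq, of "\<lambda>s. fn s 0 (vertex i)"] vertex_in_horn[OF n that, of k]
    by (simp del: horn_sel)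
  have "fn f m \<alpha> t = fn g m \<alpha> t" if "t \<le> m" for t
    using smap_to_simplex_app[of f N \<alpha> m t] smap_to_simplex_app[of g N \<alpha> m t] assms \<alpha> that
      *[OF delta_mapsD(1)[OF \<alpha> that]]
    by (simp add: compose_vertex)
  moreover have "fn f m \<alpha> \<in> delta_maps m N" "fn g m \<alpha> \<in> delta_maps m N"
    using smap_in[of f \<alpha> m] smap_in[of g \<alpha> m] assms \<alpha> by auto
  ultimately show "fn f m \<alpha> = fn g m \<alpha>"
    by (intro delta_maps_ext[where m = m]) (auto dest: delta_mapsD(3))
qed (use assms smap_ext[of f] smap_ext[of g] in auto)

text \<open>
  An inner horn contains all vertices of \<open>\<Delta>\<^sup>n\<close> and all edges between consecutive vertices. The images
  of the vertices therefore form a monotone sequence, which is the required filler.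
\<close>

lemma quasi_category_simplex: "quasi_category (std_simplex N)"
  unfolding quasi_category_def
proof (intro conjI allI impI is_sset_simplex)
  fix n k :: nat and u :: "(nat \<Rightarrow> nat, nat \<Rightarrow> nat) smap"
  assume k: "0 < k \<and> k < n" and u: "is_smap u \<and> src u = horn n k \<and> tgt u = std_simplex N"
  define w where "w i = fn u 0 (vertex i) 0" for i
  have n: "2 \<le> n"
    using k by simp
  have u_app: "fn u m \<alpha> t = w (\<alpha> t)" if "\<alpha> \<in> simp (horn n k) m" "t \<le> m" for m \<alpha> t
    using smap_to_simplex_app[of u N \<alpha> m t] u that
    by (simp add: w_def compose_vertex)
  have u_in: "fn u m \<alpha> \<in> delta_maps m N" if "\<alpha> \<in> simp (horn n k) m" for m \<alpha>
    using smap_in[of u \<alpha> m] u that by (simp del: horn_sel)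
  have w_le: "w i \<le> N" if "i \<le> n" for i
    using delta_mapsD(1)[OF u_in[OF vertex_in_horn[OF n that]], of 0] by (simp add: w_def)
  have w_Suc: "w i \<le> w (Suc i)" if "i < n" for i
  proof -
    have e: "edge i (Suc i) \<in> simp (horn n k) 1"
      using edge_in_inner_horn k that by blast
    show ?thesis
      using delta_mapsD(2)[OF u_in[OF e], of 0 1] u_app[OF e, of 0] u_app[OF e, of 1] by simp
  qed
  have w_mono: "w i \<le> w j" if "i \<le> j" "j \<le> n" for i j
    using that
  proof (induction rule: dec_induct)
    case (step j)
    then show ?case using w_Suc[of j] by simp
  qed simp
  let ?h = "simplex_map n N w"
  have h: "is_smap ?h"
    using w_le w_mono by (rule is_smap_simplex_map)
  have "scomp ?h (horn_inclusion n k) = u"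
  proof (rule smap_eqI)
    fix m \<alpha> assume "\<alpha> \<in> simp (src (scomp ?h (horn_inclusion n k))) m"
    then have \<alpha>: "\<alpha> \<in> simp (horn n k) m" by simp
    then have "compose {..m} w \<alpha> = fn u m \<alpha>"
      using u_app[OF \<alpha>] delta_mapsD(3)[OF u_in[OF \<alpha>]]
      by (intro delta_maps_ext[where m = m]) auto
    with \<alpha> show "fn (scomp ?h (horn_inclusion n k)) m \<alpha> = fn u m \<alpha>"
      by simp
  qed (use u scomp_ext[of ?h "horn_inclusion n k"] smap_ext[of u] in auto)
  with h show "\<exists>h. is_smap h \<and> src h = std_simplex n \<and> tgt h = std_simplex N \<and>
                   scomp h (horn_inclusion n k) = u"
    by (intro exI[of _ ?h]) simp
qed

section \<open>Lifting properties and copies in another universe\<close>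

lemma has_liftingD:
  assumes "has_lifting i p" "is_smap u" "src u = src i" "tgt u = src p"
    and "is_smap v" "src v = tgt i" "tgt v = tgt p" "scomp p u = scomp v i"
  obtains h where "is_smap h" "src h = tgt i" "tgt h = src p" "scomp h i = u" "scomp p h = v"
  using assms unfolding has_lifting_def by blast

lemma has_liftingI:
  assumes "\<And>u v. is_smap u \<Longrightarrow> src u = src i \<Longrightarrow> tgt u = src p \<Longrightarrow>
             is_smap v \<Longrightarrow> src v = tgt i \<Longrightarrow> tgt v = tgt p \<Longrightarrow> scomp p u = scomp v i \<Longrightarrow>
             \<exists>h. is_smap h \<and> src h = tgt i \<and> tgt h = src p \<and> scomp h i = u \<and> scomp p h = v"
  shows "has_lifting i p"
  using assms unfolding has_lifting_def by blast

lemma has_lifting_scomp: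
  assumes i: "is_smap i" and p: "is_smap p" "has_lifting i p" and q: "is_smap q" "has_lifting i q"
    and "tgt p = src q"
  shows "has_lifting i (scomp q p)"
proof (rule has_liftingI)
  fix u v assume u: "is_smap u" "src u = src i" "tgt u = src (scomp q p)"
    and v: "is_smap v" "src v = tgt i" "tgt v = tgt (scomp q p)" "scomp (scomp q p) u = scomp v i"
  obtain k where k: "is_smap k" "src k = tgt i" "tgt k = src q" "scomp k i = scomp p u" "scomp q k = v"
  proof (rule has_liftingD[OF q(2), of "scomp p u" v])
    show "scomp q (scomp p u) = scomp v i"
      using u v(4) by (simp add: scomp_assoc)
  qed (use u v assms in \<open>auto intro: is_smap_scomp\<close>)
  obtain h where "is_smap h" "src h = tgt i" "tgt h = src p" "scomp h i = u" "scomp p h = k"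
    by (rule has_liftingD[OF p(2), of u k]) (use u k assms in auto)
  then show "\<exists>h. is_smap h \<and> src h = tgt i \<and> tgt h = src (scomp q p) \<and> scomp h i = u \<and>
      scomp (scomp q p) h = v"
    using k(5) by (intro exI[of _ h]) (simp add: scomp_assoc[symmetric])
qed

text \<open>
  The simplices considered here are monotone maps, but model structures and homotopy categories
  concern simplicial sets over the universe \<open>'u\<close>. So they are copied along \<open>e\<close>, which has the left
  inverse \<open>e'\<close> on simplices.
\<close>

definition encodes :: "('a \<Rightarrow> 'b) \<Rightarrow> ('b \<Rightarrow> 'a) \<Rightarrow> 'a sset \<Rightarrow> bool" where
  "encodes e e' X \<longleftrightarrow> is_sset X \<and> (\<forall>n. \<forall>x\<in>simp X n. e' (e x) = x)"

definition copy_sset :: "('a \<Rightarrow> 'b) \<Rightarrow> ('b \<Rightarrow> 'a) \<Rightarrow> 'a sset \<Rightarrow> 'b sset" where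
  "copy_sset e e' X = \<lparr>simp = \<lambda>n. e ` simp X n, act = \<lambda>m n \<alpha> u. e (act X m n \<alpha> (e' u))\<rparr>"

definition to_copy :: "('a \<Rightarrow> 'b) \<Rightarrow> ('b \<Rightarrow> 'a) \<Rightarrow> 'a sset \<Rightarrow> ('a, 'b) smap" where
  "to_copy e e' X = mk_smap X (copy_sset e e' X) (\<lambda>_. e)"

definition from_copy :: "('a \<Rightarrow> 'b) \<Rightarrow> ('b \<Rightarrow> 'a) \<Rightarrow> 'a sset \<Rightarrow> ('b, 'a) smap" where
  "from_copy e e' X = mk_smap (copy_sset e e' X) X (\<lambda>_. e')"

definition copy_smap :: "('a \<Rightarrow> 'b) \<Rightarrow> ('b \<Rightarrow> 'a) \<Rightarrow> ('a, 'a) smap \<Rightarrow> ('b, 'b) smap" where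
  "copy_smap e e' f = scomp (to_copy e e' (tgt f)) (scomp f (from_copy e e' (src f)))"

lemma copy_sel [simp]:
  "simp (copy_sset e e' X) n = e ` simp X n"
  "act (copy_sset e e' X) m n \<alpha> u = e (act X m n \<alpha> (e' u))"
  "src (to_copy e e' X) = X" "tgt (to_copy e e' X) = copy_sset e e' X"
  "src (from_copy e e' X) = copy_sset e e' X" "tgt (from_copy e e' X) = X"
  "src (copy_smap e e' f) = copy_sset e e' (src f)" "tgt (copy_smap e e' f) = copy_sset e e' (tgt f)"
  by (simp_all add: copy_sset_def to_copy_def from_copy_def copy_smap_def)

lemma encodesD: "encodes e e' X \<Longrightarrow> is_sset X" "encodes e e' X \<Longrightarrow> x \<in> simp X n \<Longrightarrow> e' (e x) = x"
  by (auto simp: encodes_def)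

lemma to_copy_app [simp]: "x \<in> simp X n \<Longrightarrow> fn (to_copy e e' X) n x = e x"
  by (simp add: to_copy_def)

lemma from_copy_app [simp]:
  "encodes e e' X \<Longrightarrow> x \<in> simp X n \<Longrightarrow> fn (from_copy e e' X) n (e x) = x"
  by (simp add: from_copy_def encodesD)

lemma is_sset_copy:
  assumes "encodes e e' X"
  shows "is_sset (copy_sset e e' X)"
proof (rule is_ssetI)
  fix l m n \<alpha> \<beta> x
  assume \<alpha>: "\<alpha> \<in> delta_maps m n" "\<beta> \<in> delta_maps l m" and "x \<in> simp (copy_sset e e' X) n"
  then obtain y where y: "x = e y" "y \<in> simp X n" by auto
  then show "act (copy_sset e e' X) l n (compose {..l} \<alpha> \<beta>) x
      = act (copy_sset e e' X) l m \<beta> (act (copy_sset e e' X) m n \<alpha> x)"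
    using encodesD(1)[OF assms] encodesD(2)[OF assms act_in[OF encodesD(1)[OF assms] \<alpha>(1) y(2)]] \<alpha>
    by (simp add: act_act encodesD(2)[OF assms])
next
  fix m n \<alpha> x assume \<alpha>: "\<alpha> \<in> delta_maps m n" and "x \<in> simp (copy_sset e e' X) n"
  then show "act (copy_sset e e' X) m n \<alpha> x \<in> simp (copy_sset e e' X) m"
    using encodesD[OF assms] by (auto simp: act_in)
next
  fix n x assume "x \<in> simp (copy_sset e e' X) n"
  then show "act (copy_sset e e' X) n n (restrict id {..n}) x = x"
    using encodesD[OF assms] by (auto simp: act_id)
qed

lemma is_smap_to_copy: "encodes e e' X \<Longrightarrow> is_smap (to_copy e e' X)"
  unfolding to_copy_def
  by (rule is_smap_mk_smap) (auto simp: is_sset_copy encodesD)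

lemma is_smap_from_copy:
  assumes "encodes e e' X"
  shows "is_smap (from_copy e e' X)"
  unfolding from_copy_def
proof (rule is_smap_mk_smap)
  fix m n \<alpha> x assume \<alpha>: "\<alpha> \<in> delta_maps m n" and "x \<in> simp (copy_sset e e' X) n"
  then obtain y where y: "x = e y" "y \<in> simp X n" by auto
  then show "e' (act (copy_sset e e' X) m n \<alpha> x) = act X m n \<alpha> (e' x)"
    using assms encodesD(2)[OF assms act_in[OF encodesD(1)[OF assms] \<alpha> y(2)]]
    by (simp add: encodesD(2)[OF assms])
qed (use assms in \<open>auto simp: is_sset_copy encodesD\<close>)

lemma from_to_copy:
  assumes "encodes e e' X"
  shows "scomp (from_copy e e' X) (to_copy e e' X) = smap_id X"
  by (rule smap_eqI)
    (use assms scomp_ext[of "from_copy e e' X" "to_copy e e' X"] smap_ext[OF is_smap_id[OF encodesD(1)[OF assms]]]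
      in auto)

lemma to_from_copy:
  assumes "encodes e e' X"
  shows "scomp (to_copy e e' X) (from_copy e e' X) = smap_id (copy_sset e e' X)"
  by (rule smap_eqI)
    (use assms scomp_ext[of "to_copy e e' X" "from_copy e e' X"] smap_ext[OF is_smap_id[OF is_sset_copy[OF assms]]]
      in auto)

lemma is_smap_copy:
  assumes "is_smap f" "encodes e e' (src f)" "encodes e e' (tgt f)"
  shows "is_smap (copy_smap e e' f)"
  unfolding copy_smap_def using assms
  by (auto intro!: is_smap_scomp is_smap_from_copy is_smap_to_copy)

lemma copy_smap_app:
  assumes "is_smap f" "encodes e e' (src f)" "x \<in> simp (src f) n"
  shows "fn (copy_smap e e' f) n (e x) = e (fn f n x)"
  using assms smap_in[of f x n] by (simp add: copy_smap_def)

lemma copy_smap_scomp: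
  assumes "is_smap f" "is_smap g" "tgt f = src g" "encodes e e' (src f)" "encodes e e' (src g)"
  shows "copy_smap e e' (scomp g f) = scomp (copy_smap e e' g) (copy_smap e e' f)"
proof (rule smap_eqI)
  fix n u assume "u \<in> simp (src (copy_smap e e' (scomp g f))) n"
  then obtain x where "u = e x" "x \<in> simp (src f) n" by auto
  then show "fn (copy_smap e e' (scomp g f)) n u
      = fn (scomp (copy_smap e e' g) (copy_smap e e' f)) n u"
    using assms smap_in[of f x n] by (simp add: copy_smap_app is_smap_scomp)
qed (simp_all add: copy_smap_def scomp_def)

lemma copy_smap_id: "encodes e e' X \<Longrightarrow> copy_smap e e' (smap_id X) = smap_id (copy_sset e e' X)"
  by (simp add: copy_smap_def scomp_id_left is_smap_from_copy to_from_copy)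

lemma from_copy_natural:
  assumes "is_smap f" "encodes e e' (src f)" "encodes e e' (tgt f)"
  shows "scomp (from_copy e e' (tgt f)) (copy_smap e e' f) = scomp f (from_copy e e' (src f))"
proof -
  have "is_smap (scomp f (from_copy e e' (src f)))"
    using assms by (simp add: is_smap_scomp is_smap_from_copy)
  then show ?thesis
    unfolding copy_smap_def using assms
    by (subst scomp_assoc) (auto simp: from_to_copy scomp_id_left)
qed

lemma to_copy_natural:
  assumes "is_smap f" "encodes e e' (src f)" "encodes e e' (tgt f)"
  shows "scomp (copy_smap e e' f) (to_copy e e' (src f)) = scomp (to_copy e e' (tgt f)) f"
proof (rule smap_eqI)
  fix n x assume "x \<in> simp (src (scomp (copy_smap e e' f) (to_copy e e' (src f)))) n"
  then show "fn (scomp (copy_smap e e' f) (to_copy e e' (src f))) n x = fn (scomp (to_copy e e' (tgt f)) f) n x"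
    using assms smap_in[of f x n] by (simp add: copy_smap_app)
qed (simp_all add: scomp_def)

text \<open>
  A copy is isomorphic to the original by \<open>to_copy\<close> and \<open>from_copy\<close>, which are natural. Lifting
  problems are transported along these isomorphisms, and so are their solutions.
\<close>

lemma has_lifting_copy_right:
  assumes p: "is_smap p" "encodes e e' (src p)" "encodes e e' (tgt p)"
    and i: "is_smap i" and "has_lifting i p"
  shows "has_lifting i (copy_smap e e' p)"
proof (rule has_liftingI)
  let ?to = "to_copy e e' (src p)" and ?from = "from_copy e e' (src p)"
    and ?to' = "to_copy e e' (tgt p)" and ?from' = "from_copy e e' (tgt p)"
  have c: "is_smap ?to" "is_smap ?from" "is_smap ?to'" "is_smap ?from'" "is_smap (copy_smap e e' p)"
    using p by (auto intro: is_smap_to_copy is_smap_from_copy is_smap_copy)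
  fix u v assume u: "is_smap u" "src u = src i" "tgt u = src (copy_smap e e' p)"
    and v: "is_smap v" "src v = tgt i" "tgt v = tgt (copy_smap e e' p)"
    and sq: "scomp (copy_smap e e' p) u = scomp v i"
  have sq': "scomp p (scomp ?from u) = scomp (scomp ?from' v) i"
  proof -
    have "scomp p (scomp ?from u) = scomp (scomp ?from' (copy_smap e e' p)) u"
      using p u by (simp add: scomp_assoc from_copy_natural)
    also have "\<dots> = scomp ?from' (scomp v i)"
      using u by (simp add: scomp_assoc[symmetric] sq)
    also have "\<dots> = scomp (scomp ?from' v) i"
      using i v by (simp add: scomp_assoc)
    finally show ?thesis .
  qed
  obtain h where h: "is_smap h" "src h = tgt i" "tgt h = src p"
      "scomp h i = scomp ?from u" "scomp p h = scomp ?from' v"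
    by (rule has_liftingD[OF assms(5) _ _ _ _ _ _ sq']) (use u v c in \<open>auto intro: is_smap_scomp\<close>)
  have "scomp (scomp ?to h) i = scomp (scomp ?to ?from) u"
    using h i u by (simp add: scomp_assoc[symmetric])
  then have "scomp (scomp ?to h) i = u"
    using u p by (simp add: to_from_copy scomp_id_left)
  moreover have "scomp (copy_smap e e' p) (scomp ?to h) = scomp (scomp ?to' ?from') v"
  proof -
    have "scomp (copy_smap e e' p) (scomp ?to h) = scomp (scomp ?to' p) h"
      using h p by (simp add: scomp_assoc to_copy_natural)
    also have "\<dots> = scomp ?to' (scomp ?from' v)"
      using h by (simp add: scomp_assoc[symmetric])
    finally show ?thesis
      using v by (simp add: scomp_assoc)
  qed
  then have "scomp (copy_smap e e' p) (scomp ?to h) = v"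
    using v p by (simp add: to_from_copy scomp_id_left)
  ultimately show "\<exists>h. is_smap h \<and> src h = tgt i \<and> tgt h = src (copy_smap e e' p) \<and>
      scomp h i = u \<and> scomp (copy_smap e e' p) h = v"
    using h c by (intro exI[of _ "scomp ?to h"]) (auto intro: is_smap_scomp)
qed

lemma has_lifting_copy_left:
  assumes i: "is_smap i" "encodes e e' (src i)" "encodes e e' (tgt i)"
    and q: "is_smap q" and "has_lifting i q"
  shows "has_lifting (copy_smap e e' i) q"
proof (rule has_liftingI)
  let ?to = "to_copy e e' (src i)" and ?from = "from_copy e e' (src i)"
    and ?to' = "to_copy e e' (tgt i)" and ?from' = "from_copy e e' (tgt i)"
  have c: "is_smap ?to" "is_smap ?from" "is_smap ?to'" "is_smap ?from'" "is_smap (copy_smap e e' i)"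
    using i by (auto intro: is_smap_to_copy is_smap_from_copy is_smap_copy)
  fix u v assume u: "is_smap u" "src u = src (copy_smap e e' i)" "tgt u = src q"
    and v: "is_smap v" "src v = tgt (copy_smap e e' i)" "tgt v = tgt q"
    and sq: "scomp q u = scomp v (copy_smap e e' i)"
  have sq': "scomp q (scomp u ?to) = scomp (scomp v ?to') i"
  proof -
    have "scomp q (scomp u ?to) = scomp (scomp v (copy_smap e e' i)) ?to"
      using c u by (simp add: scomp_assoc sq)
    also have "\<dots> = scomp v (scomp ?to' i)"
      using c i by (simp add: scomp_assoc[symmetric] to_copy_natural)
    also have "\<dots> = scomp (scomp v ?to') i"
      using i by (simp add: scomp_assoc)
    finally show ?thesis .
  qed
  obtain h where h: "is_smap h" "src h = tgt i" "tgt h = src q"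
      "scomp h i = scomp u ?to" "scomp q h = scomp v ?to'"
    by (rule has_liftingD[OF assms(5) _ _ _ _ _ _ sq']) (use u v c in \<open>auto intro: is_smap_scomp\<close>)
  have "scomp (scomp h ?from') (copy_smap e e' i) = scomp h (scomp i ?from)"
    using c i by (simp add: scomp_assoc[symmetric] from_copy_natural)
  also have "\<dots> = scomp u (scomp ?to ?from)"
    using c h by (simp add: scomp_assoc)
  also have "\<dots> = u"
    using u i by (simp add: to_from_copy scomp_id_right)
  finally have "scomp (scomp h ?from') (copy_smap e e' i) = u" .
  moreover have "scomp q (scomp h ?from') = scomp v (scomp ?to' ?from')"
    using c h by (simp add: scomp_assoc)
  then have "scomp q (scomp h ?from') = v"
    using v i by (simp add: to_from_copy scomp_id_right)
  ultimately show "\<exists>h. is_smap h \<and> src h = tgt (copy_smap e e' i) \<and> tgt h = src q \<and>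
      scomp h (copy_smap e e' i) = u \<and> scomp q h = v"
    using h c by (intro exI[of _ "scomp h ?from'"]) (auto intro: is_smap_scomp)
qed

lemma quasi_category_copy:
  assumes X: "encodes e e' X" and "quasi_category X"
  shows "quasi_category (copy_sset e e' X)"
  unfolding quasi_category_def
proof (intro conjI allI impI is_sset_copy X)
  let ?to = "to_copy e e' X" and ?from = "from_copy e e' X"
  fix n k :: nat and u
  assume k: "0 < k \<and> k < n" and u: "is_smap u \<and> src u = horn n k \<and> tgt u = copy_sset e e' X"
  have "is_smap (scomp ?from u) \<and> src (scomp ?from u) = horn n k \<and> tgt (scomp ?from u) = X"
    using u X by (auto intro: is_smap_scomp is_smap_from_copy)
  then obtain h where h: "is_smap h" "src h = std_simplex n" "tgt h = X"
      "scomp h (horn_inclusion n k) = scomp ?from u"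
    using assms(2) k unfolding quasi_category_def by blast
  have "scomp (scomp ?to h) (horn_inclusion n k) = scomp (scomp ?to ?from) u"
    using h u by (simp add: scomp_assoc[symmetric] is_smap_horn_inclusion)
  also have "\<dots> = u"
    using u X by (simp add: to_from_copy scomp_id_left)
  finally show "\<exists>h. is_smap h \<and> src h = std_simplex n \<and> tgt h = copy_sset e e' X \<and>
      scomp h (horn_inclusion n k) = u"
    using h X by (intro exI[of _ "scomp ?to h"]) (auto intro: is_smap_scomp is_smap_to_copy)
qed

section \<open>The triangle with one collapsed edge\<close>

text \<open>
  A simplex of \<open>\<Delta>\<^sup>2\<close> lies in the edge \<open>01\<close> unless its last vertex is \<open>2\<close>. All those of a given dimension
  are identified, and \<open>collapse\<close> chooses the constant map \<open>0\<close> to represent them.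
\<close>

definition collapse :: "nat \<Rightarrow> (nat \<Rightarrow> nat) \<Rightarrow> nat \<Rightarrow> nat" where
  "collapse m \<gamma> = (if \<gamma> m = 2 then \<gamma> else (\<lambda>_\<in>{..m}. 0))"

definition collapsed_triangle :: "(nat \<Rightarrow> nat) sset" where
  "collapsed_triangle = \<lparr>simp = \<lambda>m. {\<gamma> \<in> delta_maps m 2. collapse m \<gamma> = \<gamma>},
                         act = \<lambda>l m \<beta> \<gamma>. collapse l (compose {..l} \<gamma> \<beta>)\<rparr>"

lemma collapsed_triangle_sel [simp]:
  "simp collapsed_triangle m = {\<gamma> \<in> delta_maps m 2. collapse m \<gamma> = \<gamma>}"
  "act collapsed_triangle l m \<beta> \<gamma> = collapse l (compose {..l} \<gamma> \<beta>)"
  by (simp_all add: collapsed_triangle_def)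

lemma collapse_idem [simp]: "collapse m (collapse m \<gamma>) = collapse m \<gamma>"
  by (simp add: collapse_def)

lemma collapse_delta_maps: "\<gamma> \<in> delta_maps m 2 \<Longrightarrow> collapse m \<gamma> \<in> delta_maps m 2"
  by (simp add: collapse_def restrict_delta_maps)

lemma delta_maps_2_less:
  assumes "\<gamma> \<in> delta_maps m 2" "\<gamma> m \<noteq> 2" "i \<le> m"
  shows "\<gamma> i < 2"
  using delta_mapsD(1)[OF assms(1), of m] delta_mapsD(2)[OF assms(1,3)] assms(2) by simp

lemma collapse_compose:
  assumes "\<gamma> \<in> delta_maps m 2" "\<beta> \<in> delta_maps l m"
  shows "collapse l (compose {..l} (collapse m \<gamma>) \<beta>) = collapse l (compose {..l} \<gamma> \<beta>)"
proof (cases "\<gamma> m = 2")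
  case False
  have l: "\<beta> l \<le> m"
    using delta_mapsD(1)[OF assms(2)] by simp
  from delta_maps_2_less[OF assms(1) False l] l False show ?thesis
    by (simp add: collapse_def)
qed (simp add: collapse_def)

lemma is_sset_collapsed_triangle: "is_sset collapsed_triangle"
proof (rule is_ssetI)
  show "act collapsed_triangle m n \<alpha> x \<in> simp collapsed_triangle m"
    if "\<alpha> \<in> delta_maps m n" "x \<in> simp collapsed_triangle n" for m n \<alpha> x
    using that by (auto intro: collapse_delta_maps delta_maps_compose)
  show "act collapsed_triangle l n (compose {..l} \<alpha> \<beta>) x
      = act collapsed_triangle l m \<beta> (act collapsed_triangle m n \<alpha> x)"
    if "\<alpha> \<in> delta_maps m n" "\<beta> \<in> delta_maps l m" "x \<in> simp collapsed_triangle n" for l m n \<alpha> \<beta> x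
    using that collapse_compose[OF delta_maps_compose[of x n 2 \<alpha> m] that(2)]
    by (simp add: compose_assoc_delta)
qed (auto simp: compose_id_delta)

definition collapse_map :: "(nat \<Rightarrow> nat, nat \<Rightarrow> nat) smap" where
  "collapse_map = mk_smap (std_simplex 2) collapsed_triangle collapse"

lemma collapse_map_sel [simp]:
  "src collapse_map = std_simplex 2" "tgt collapse_map = collapsed_triangle"
  "\<gamma> \<in> delta_maps m 2 \<Longrightarrow> fn collapse_map m \<gamma> = collapse m \<gamma>"
  by (simp_all add: collapse_map_def)

lemma is_smap_collapse_map: "is_smap collapse_map"
  unfolding collapse_map_def
  by (rule is_smap_mk_smap)
    (auto simp: is_sset_simplex is_sset_collapsed_triangle collapse_delta_maps collapse_compose)

definition long_edge :: "(nat \<Rightarrow> nat, nat \<Rightarrow> nat) smap" where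
  "long_edge = scomp collapse_map (simplex_map 1 2 (\<lambda>i. 2 * i))"

definition short_edge :: "(nat \<Rightarrow> nat, nat \<Rightarrow> nat) smap" where
  "short_edge = scomp collapse_map (simplex_map 1 2 Suc)"

definition retraction :: "(nat \<Rightarrow> nat, nat \<Rightarrow> nat) smap" where
  "retraction = mk_smap collapsed_triangle (std_simplex 1) (\<lambda>m. compose {..m} (\<lambda>i. i - 1))"

lemma is_smap_edges: "is_smap long_edge" "is_smap short_edge"
  unfolding long_edge_def short_edge_def
  by (auto intro!: is_smap_scomp is_smap_simplex_map is_smap_collapse_map)

lemma pred_collapse:
  assumes "\<gamma> \<in> delta_maps m 2"
  shows "compose {..m} (\<lambda>i. i - 1) (collapse m \<gamma>) = compose {..m} (\<lambda>i. i - 1) \<gamma>"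
proof (rule delta_maps_ext[where m = m])
  fix i assume "i \<le> m"
  then show "compose {..m} (\<lambda>i. i - 1) (collapse m \<gamma>) i = compose {..m} (\<lambda>i. i - 1) \<gamma> i"
    using delta_maps_2_less[OF assms, of i] by (auto simp: collapse_def)
qed auto

lemma is_smap_retraction: "is_smap retraction"
  unfolding retraction_def
proof (rule is_smap_mk_smap)
  fix m n \<alpha> x assume "\<alpha> \<in> delta_maps m n" "x \<in> simp collapsed_triangle n"
  then show "compose {..m} (\<lambda>i. i - 1) (act collapsed_triangle m n \<alpha> x)
      = act (std_simplex 1) m n \<alpha> (compose {..n} (\<lambda>i. i - 1) x)"
    using delta_maps_compose[of x n 2 \<alpha> m]
    by (simp add: pred_collapse compose_assoc_delta del: One_nat_def)
next
  fix n x assume "x \<in> simp collapsed_triangle n"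
  then show "compose {..n} (\<lambda>i. i - 1) x \<in> simp (std_simplex 1) n"
    by (auto intro: compose_delta_maps)
qed (auto simp: is_sset_simplex is_sset_collapsed_triangle)

lemma edges_sel [simp]:
  "src long_edge = std_simplex 1" "tgt long_edge = collapsed_triangle"
  "src short_edge = std_simplex 1" "tgt short_edge = collapsed_triangle"
  "src retraction = collapsed_triangle" "tgt retraction = std_simplex 1"
  by (simp_all add: long_edge_def short_edge_def retraction_def)

lemma edges_app:
  "\<alpha> \<in> delta_maps m 1 \<Longrightarrow> fn long_edge m \<alpha> = collapse m (compose {..m} (\<lambda>i. 2 * i) \<alpha>)"
  "\<alpha> \<in> delta_maps m 1 \<Longrightarrow> fn short_edge m \<alpha> = collapse m (compose {..m} Suc \<alpha>)"
  "\<gamma> \<in> simp collapsed_triangle m \<Longrightarrow> fn retraction m \<gamma> = compose {..m} (\<lambda>i. i - 1) \<gamma>"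
proof -
  show "fn long_edge m \<alpha> = collapse m (compose {..m} (\<lambda>i. 2 * i) \<alpha>)" if "\<alpha> \<in> delta_maps m 1"
    using that compose_delta_maps[OF that, of "\<lambda>i. 2 * i" 2] by (simp add: long_edge_def)
  show "fn short_edge m \<alpha> = collapse m (compose {..m} Suc \<alpha>)" if "\<alpha> \<in> delta_maps m 1"
    using that compose_delta_maps[OF that, of Suc 2] by (simp add: short_edge_def)
qed (simp add: retraction_def)

lemma retraction_edges:
  "scomp retraction long_edge = smap_id (std_simplex 1)"
  "scomp retraction short_edge = smap_id (std_simplex 1)"
proof -
  have *: "scomp retraction (scomp collapse_map (simplex_map 1 2 \<phi>)) = smap_id (std_simplex 1)"
    if \<phi>: "\<And>i. i \<le> 1 \<Longrightarrow> \<phi> i \<le> 2" "\<And>i j. i \<le> j \<Longrightarrow> j \<le> 1 \<Longrightarrow> \<phi> i \<le> \<phi> j"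
      "\<And>i. i \<le> 1 \<Longrightarrow> \<phi> i - 1 = i" for \<phi> :: "nat \<Rightarrow> nat"
  proof (rule smap_eqI)
    fix m \<alpha> assume "\<alpha> \<in> simp (src (scomp retraction (scomp collapse_map (simplex_map 1 2 \<phi>)))) m"
    then have \<alpha>: "\<alpha> \<in> delta_maps m 1" by simp
    have \<phi>\<alpha>: "compose {..m} \<phi> \<alpha> \<in> delta_maps m 2"
      using compose_delta_maps[OF \<alpha>] \<phi> by blast
    have "compose {..m} (\<lambda>i. i - 1) (compose {..m} \<phi> \<alpha>) = \<alpha>"
      by (rule delta_maps_ext[where m = m]) (use \<phi>(3) delta_mapsD(1,3)[OF \<alpha>] in auto)
    then show "fn (scomp retraction (scomp collapse_map (simplex_map 1 2 \<phi>))) m \<alpha>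
        = fn (smap_id (std_simplex 1)) m \<alpha>"
      using \<alpha> \<phi>\<alpha> pred_collapse[OF \<phi>\<alpha>]
      by (simp add: edges_app(3) collapse_delta_maps del: One_nat_def)
  qed (simp_all add: scomp_def smap_id_def mk_smap_def)
  show "scomp retraction long_edge = smap_id (std_simplex 1)"
    unfolding long_edge_def by (rule *) auto
  show "scomp retraction short_edge = smap_id (std_simplex 1)"
    unfolding short_edge_def by (rule *) auto
qed

text \<open>
  Suppose a simplex of \<open>T\<close> has a vertex \<open>1\<close>. It is not the constant simplex \<open>0\<close>, so it ends with the
  vertex \<open>2\<close>, and the edge that follows its last vertex \<open>1\<close> is \<open>12\<close>. This edge connects consecutive vertices,
  so if the simplex fills an inner horn then the edge belongs to the horn and cannot come from
  \<open>\<Delta>\<^sup>1\<close>. Hence a filler has only the vertices \<open>0\<close> and \<open>2\<close>, and applying the retraction lifts it.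
\<close>

lemma long_edge_lifts_inner_horns:
  assumes "0 < k" "k < n"
  shows "has_lifting (horn_inclusion n k) long_edge"
proof (rule has_liftingI)
  fix u v
  assume u: "is_smap u" "src u = src (horn_inclusion n k)" "tgt u = src long_edge"
    and v: "is_smap v" "src v = tgt (horn_inclusion n k)" "tgt v = tgt long_edge"
    and sq: "scomp long_edge u = scomp v (horn_inclusion n k)"
  define x where "x = fn v n (restrict id {..n})"
  have x: "x \<in> simp collapsed_triangle n"
    using smap_in[OF v(1), of "restrict id {..n}" n] v by (simp add: x_def id_delta_maps)
  then have x2: "x \<in> delta_maps n 2" by simp
  have v_app: "fn v m \<alpha> = collapse m (compose {..m} x \<alpha>)" if "\<alpha> \<in> delta_maps m n" for m \<alpha>
    using smap_from_simplex[OF v(1) _ that] v(2,3) by (simp add: x_def)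
  have no1: "x t \<noteq> 1" if t: "t \<le> n" for t
  proof
    assume xt: "x t = 1"
    then have xn: "x n = 2"
      using x t by (auto simp: collapse_def split: if_splits)
    let ?P = "\<lambda>s. s \<le> n \<and> x s = 1"
    define s where "s = (GREATEST s. ?P s)"
    have s: "s \<le> n" "x s = 1"
      using GreatestI_nat[of ?P t n] xt t unfolding s_def by auto
    have s_max: "\<not> ?P (Suc s)"
      using Greatest_le_nat[of ?P "Suc s" n] unfolding s_def by fastforce
    have "s < n"
      using s xn by (cases "s = n") auto
    then have xs: "x (Suc s) = 2"
      using s_max delta_mapsD(1)[OF x2, of "Suc s"] delta_mapsD(2)[OF x2, of s "Suc s"] s(2) by auto
    have e: "edge s (Suc s) \<in> simp (horn n k) 1"
      using assms \<open>s < n\<close> by (rule edge_in_inner_horn)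
    then have eu: "fn u 1 (edge s (Suc s)) \<in> delta_maps 1 1"
      using smap_in[OF u(1), of _ 1] u by (simp del: horn_sel)
    have "fn long_edge 1 (fn u 1 (edge s (Suc s))) = fn v 1 (edge s (Suc s))"
      using arg_cong[OF sq, of "\<lambda>f. fn f 1 (edge s (Suc s))"] u e by (simp del: horn_sel)
    moreover have "fn v 1 (edge s (Suc s)) 0 = 1"
      using v_app[of "edge s (Suc s)" 1] e s xs by (simp add: collapse_def)
    moreover have "fn long_edge 1 (fn u 1 (edge s (Suc s))) 0 \<noteq> 1"
      using eu by (auto simp: edges_app(1) collapse_def simp del: One_nat_def)
    ultimately show False by simp
  qed
  let ?h = "scomp retraction v"
  have "scomp long_edge ?h = v"
  proof (rule smap_eqI)
    fix m \<alpha> assume "\<alpha> \<in> simp (src (scomp long_edge ?h)) m"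
    then have \<alpha>: "\<alpha> \<in> delta_maps m n" using v by simp
    define y where "y = fn v m \<alpha>"
    have y: "y \<in> simp collapsed_triangle m"
      using smap_in[OF v(1), of \<alpha> m] \<alpha> v unfolding y_def by simp
    then have y2: "y \<in> delta_maps m 2" by simp
    have "2 * (y i - 1) = y i" if i: "i \<le> m" for i
    proof -
      have "y i \<noteq> 1"
        using no1[OF delta_mapsD(1)[OF \<alpha> i]] i by (simp add: y_def v_app[OF \<alpha>] collapse_def)
      moreover have "y i \<le> 2"
        using delta_mapsD(1)[OF y2 i] .
      ultimately show ?thesis by presburger
    qed
    then have "compose {..m} (\<lambda>i. 2 * i) (compose {..m} (\<lambda>i. i - 1) y) = y"
      using delta_mapsD(3)[OF y2] by (intro delta_maps_ext[where m = m]) auto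
    moreover have "compose {..m} (\<lambda>i. i - 1) y \<in> delta_maps m 1"
      using y2 by (rule compose_delta_maps) auto
    ultimately show "fn (scomp long_edge ?h) m \<alpha> = fn v m \<alpha>"
      using \<alpha> v y by (simp add: edges_app y_def[symmetric] del: One_nat_def)
  qed (use v scomp_ext[of long_edge ?h] smap_ext[OF v(1)] in auto)
  moreover have "scomp ?h (horn_inclusion n k) = scomp (scomp retraction long_edge) u"
    using v u sq by (simp add: scomp_assoc[symmetric] is_smap_horn_inclusion)
  then have "scomp ?h (horn_inclusion n k) = u"
    using u by (simp add: retraction_edges scomp_id_left del: One_nat_def)
  ultimately show "\<exists>h. is_smap h \<and> src h = tgt (horn_inclusion n k) \<and> tgt h = src long_edge \<and>
      scomp h (horn_inclusion n k) = u \<and> scomp long_edge h = v"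
    using v by (intro exI[of _ ?h]) (auto intro: is_smap_scomp is_smap_retraction)
qed

text \<open>
  The inclusion of the edge \<open>12\<close> is a pushout of \<open>\<Lambda>\<^sup>2\<^sub>1 \<rightarrow> \<Delta>\<^sup>2\<close> along the map that collapses the edge
  \<open>01\<close>. Lifts against the horn inclusion descend to the pushout.
\<close>

lemma has_lifting_short_edge:
  assumes q: "is_smap q" and horn: "has_lifting (horn_inclusion 2 1) q"
  shows "has_lifting short_edge q"
proof (rule has_liftingI)
  let ?i = "horn_inclusion 2 1" and ?s = "simplex_map 2 1 (\<lambda>i. i - 1)"
  have s: "is_smap ?s"
    by (rule is_smap_simplex_map) auto
  fix u v
  assume u: "is_smap u" "src u = src short_edge" "tgt u = src q"
    and v: "is_smap v" "src v = tgt short_edge" "tgt v = tgt q"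
    and sq: "scomp q u = scomp v short_edge"
  \<comment> \<open>The candidate horn in the source of \<open>q\<close> is \<open>u\<close> pulled back along the degeneracy \<open>0, 1 \<mapsto> 0\<close>,
    so its edge \<open>01\<close> is degenerate.  It lies over the triangle \<open>v\<close> because, on the horn, collapsing
    agrees with this degeneracy followed by the inclusion of the edge \<open>12\<close>.\<close>
  have horn_square: "scomp short_edge (scomp ?s ?i) = scomp collapse_map ?i"
  proof (rule smap_eqI)
    fix m \<alpha> assume "\<alpha> \<in> simp (src (scomp short_edge (scomp ?s ?i))) m"
    then have \<alpha>: "\<alpha> \<in> simp (horn 2 1) m" by simp
    then have \<alpha>2: "\<alpha> \<in> delta_maps m 2" by simp
    have s\<alpha>: "compose {..m} (\<lambda>i. i - 1) \<alpha> \<in> delta_maps m 1"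
      using \<alpha>2 by (rule compose_delta_maps) auto
    have "collapse m (compose {..m} Suc (compose {..m} (\<lambda>i. i - 1) \<alpha>)) = collapse m \<alpha>"
    proof (cases "\<alpha> m = 2")
      case True
      obtain j where j: "j \<le> 2" "j \<noteq> 1" "j \<notin> \<alpha> ` {..m}"
        using \<alpha> by auto
      then have "j \<noteq> 2"
        using True by (metis atMost_iff imageI order_refl)
      with j have "0 \<notin> \<alpha> ` {..m}"
        by (cases "j = 0") auto
      then have "Suc (\<alpha> i - 1) = \<alpha> i" if "i \<le> m" for i
        using that by (metis Suc_pred' atMost_iff bot_nat_0.not_eq_extremum image_eqI)
      then have "compose {..m} Suc (compose {..m} (\<lambda>i. i - 1) \<alpha>) = \<alpha>"
        using delta_mapsD(3)[OF \<alpha>2] by (intro delta_maps_ext[where m = m]) auto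
      then show ?thesis by simp
    next
      case False
      then show ?thesis
        using delta_maps_2_less[OF \<alpha>2 False, of m] by (simp add: collapse_def)
    qed
    then show "fn (scomp short_edge (scomp ?s ?i)) m \<alpha> = fn (scomp collapse_map ?i) m \<alpha>"
      using \<alpha> \<alpha>2 s\<alpha> by (simp add: edges_app(2) del: horn_sel One_nat_def)
  qed (simp_all add: scomp_def)
  have "scomp q (scomp u (scomp ?s ?i)) = scomp (scomp q u) (scomp ?s ?i)"
    using u s by (intro scomp_assoc) (auto intro: is_smap_scomp is_smap_horn_inclusion)
  also have "\<dots> = scomp v (scomp short_edge (scomp ?s ?i))"
    unfolding sq using v s by (intro scomp_assoc[symmetric]) (auto intro: is_smap_scomp is_smap_horn_inclusion)
  also have "\<dots> = scomp (scomp v collapse_map) ?i"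
    using horn_square v
    by (simp add: scomp_assoc is_smap_horn_inclusion)
  finally have sq': "scomp q (scomp u (scomp ?s ?i)) = scomp (scomp v collapse_map) ?i" .
  obtain h where h: "is_smap h" "src h = std_simplex 2" "tgt h = src q"
    "scomp h ?i = scomp u (scomp ?s ?i)" "scomp q h = scomp v collapse_map"
    by (rule has_liftingD[OF horn _ _ _ _ _ _ sq'])
      (use u v s in \<open>auto intro!: is_smap_scomp is_smap_horn_inclusion is_smap_collapse_map\<close>)
  \<comment> \<open>The filler takes a simplex of the edge \<open>01\<close> to a degenerate simplex, hence factors through the
    collapse.\<close>
  have h_horn: "fn h m \<alpha> = fn u m (compose {..m} (\<lambda>i. i - 1) \<alpha>)" if "\<alpha> \<in> simp (horn 2 1) m" for m \<alpha>
    using arg_cong[OF h(4), of "\<lambda>f. fn f m \<alpha>"] that by (simp del: One_nat_def)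
  have h_collapse: "fn h m (collapse m \<gamma>) = fn h m \<gamma>" if \<gamma>: "\<gamma> \<in> delta_maps m 2" for m \<gamma>
  proof (cases "\<gamma> m = 2")
    case False
    have "\<gamma> i \<noteq> 2" if "i \<le> m" for i
      using delta_maps_2_less[OF \<gamma> False that] by simp
    then have "\<gamma> \<in> simp (horn 2 1) m"
      using \<gamma> by (auto intro!: exI[of _ 2])
    moreover have "collapse m \<gamma> \<in> simp (horn 2 1) m"
      using collapse_delta_maps[OF \<gamma>] False by (auto simp: collapse_def intro!: exI[of _ 2])
    ultimately show ?thesis
      by (simp add: h_horn pred_collapse[OF \<gamma>] del: horn_sel One_nat_def)
  qed (simp add: collapse_def)
  let ?h = "mk_smap collapsed_triangle (src q) (fn h)"
  have h': "is_smap ?h"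
  proof (rule is_smap_mk_smap)
    fix m n \<alpha> x assume \<alpha>: "\<alpha> \<in> delta_maps m n" and x: "x \<in> simp collapsed_triangle n"
    then show "fn h m (act collapsed_triangle m n \<alpha> x) = act (src q) m n \<alpha> (fn h n x)"
      using smap_act[OF h(1) \<alpha>, of x] h(2,3) h_collapse[OF delta_maps_compose[of x n 2 \<alpha> m]] by simp
  qed (use q h smap_in[OF h(1)] in \<open>auto simp: is_sset_collapsed_triangle smap_sset\<close>)
  have "scomp ?h short_edge = u"
  proof (rule smap_eqI)
    fix m \<alpha> assume "\<alpha> \<in> simp (src (scomp ?h short_edge)) m"
    then have \<alpha>: "\<alpha> \<in> delta_maps m 1" by simp
    have S\<alpha>: "compose {..m} Suc \<alpha> \<in> delta_maps m 2"
      using \<alpha> by (rule compose_delta_maps) auto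
    then have "compose {..m} Suc \<alpha> \<in> simp (horn 2 1) m"
      by (auto intro!: exI[of _ 0])
    then have "fn h m (collapse m (compose {..m} Suc \<alpha>))
        = fn u m (compose {..m} (\<lambda>i. i - 1) (compose {..m} Suc \<alpha>))"
      using S\<alpha> by (simp add: h_collapse h_horn del: horn_sel)
    also have "compose {..m} (\<lambda>i. i - 1) (compose {..m} Suc \<alpha>) = \<alpha>"
      using delta_mapsD(3)[OF \<alpha>] by (intro delta_maps_ext[where m = m]) auto
    finally show "fn (scomp ?h short_edge) m \<alpha> = fn u m \<alpha>"
      using \<alpha> collapse_delta_maps[OF S\<alpha>] by (simp add: edges_app(2))
  qed (use u scomp_ext[of ?h short_edge] smap_ext[OF u(1)] in auto)
  moreover have "scomp q ?h = v"
  proof (rule smap_eqI)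
    fix m \<gamma> assume "\<gamma> \<in> simp (src (scomp q ?h)) m"
    then have \<gamma>: "\<gamma> \<in> delta_maps m 2" "collapse m \<gamma> = \<gamma>" by auto
    then show "fn (scomp q ?h) m \<gamma> = fn v m \<gamma>"
      using arg_cong[OF h(5), of "\<lambda>f. fn f m \<gamma>"] h(2) by simp
  qed (use v scomp_ext[of q ?h] smap_ext[OF v(1)] in auto)
  ultimately show "\<exists>h. is_smap h \<and> src h = tgt short_edge \<and> tgt h = src q \<and>
      scomp h short_edge = u \<and> scomp q h = v"
    using h' by (intro exI[of _ ?h]) simp
qed

section \<open>Fibrations of Joyal's model structure\<close>

lemma joyal_wfs: "joyal_model_structure W C F \<Longrightarrow> weak_factorisation_system (C \<inter> W) F"
  unfolding joyal_model_structure_def model_structure_def by blast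

lemma joyal_acyclic_cofibration_iff:
  "joyal_model_structure W C F \<Longrightarrow>
   i \<in> C \<and> i \<in> W \<longleftrightarrow> is_smap i \<and> (\<forall>p\<in>F. has_lifting i p)"
  using joyal_wfs unfolding weak_factorisation_system_def by blast

lemma joyal_fibration_iff:
  "joyal_model_structure W C F \<Longrightarrow>
   p \<in> F \<longleftrightarrow> is_smap p \<and> (\<forall>i\<in>C \<inter> W. has_lifting i p)"
  using joyal_wfs unfolding weak_factorisation_system_def by blast

lemma joyal_factorisation:
  assumes "joyal_model_structure W C F" "is_smap f"
  obtains i p where "i \<in> C \<inter> W" "p \<in> F" "tgt i = src p" "f = scomp p i"
proof -
  have "\<forall>f. is_smap f \<longrightarrow> (\<exists>i\<in>C \<inter> W. \<exists>p\<in>F. tgt i = src p \<and> f = scomp p i)"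
    using joyal_wfs[OF assms(1)] unfolding weak_factorisation_system_def by (elim conjE)
  then show thesis
    using assms(2) that by blast
qed

text \<open>
  Fibrations compose, so an object fibred over a fibrant one is fibrant.
\<close>

lemma joyal_fibrant_total_space:
  assumes J: "joyal_model_structure W C F" and p: "p \<in> F" and "quasi_category (tgt p)"
  shows "quasi_category (src p)"
proof -
  have "is_smap p"
    using p joyal_fibration_iff[OF J] by blast
  then have sset: "is_sset (src p)" "is_sset (tgt p)"
    by (simp_all add: smap_sset)
  then have "fibrant F (tgt p)"
    using assms by (simp add: joyal_model_structure_def)
  then obtain t where t: "t \<in> F" "src t = tgt p" "terminal_sset (tgt t)"
    by (auto simp: fibrant_def)
  have "is_smap t"
    using t joyal_fibration_iff[OF J] by blast
  have "has_lifting i (scomp t p)" if "i \<in> C \<inter> W" for i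
  proof (rule has_lifting_scomp)
    show "is_smap i" "has_lifting i p" "has_lifting i t"
      using that p t joyal_acyclic_cofibration_iff[OF J, of i] by blast+
  qed (use t \<open>is_smap p\<close> \<open>is_smap t\<close> in simp_all)
  then have "scomp t p \<in> F"
    using joyal_fibration_iff[OF J] is_smap_scomp[OF \<open>is_smap p\<close> \<open>is_smap t\<close>] t(2) by simp
  then have "fibrant F (src p)"
    unfolding fibrant_def using t(3) by (intro bexI[of _ "scomp t p"]) auto
  then show ?thesis
    using J sset by (simp add: joyal_model_structure_def)
qed

text \<open>
  The copy of \<open>\<Lambda>\<^sup>n\<^sub>k \<rightarrow> \<Delta>\<^sup>n\<close> is a retract of the acyclic cofibration \<open>j\<close> in a factorisation \<open>p \<circ> j\<close>: the
  quasi-category in the middle admits an extension \<open>s\<close> of \<open>j\<close> to \<open>\<Delta>\<^sup>n\<close>, and \<open>p \<circ> s\<close> can only be the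
  identity.
\<close>

lemma joyal_fibration_lifts_horn:
  fixes q :: "('u, 'u) smap" and e :: "(nat \<Rightarrow> nat) \<Rightarrow> 'u"
  assumes J: "joyal_model_structure W C F" and q: "q \<in> F" and k: "0 < k" "k < n"
    and e: "encodes e e' (horn n k)" "encodes e e' (std_simplex n)"
  shows "has_lifting (horn_inclusion n k) q"
proof (rule has_liftingI)
  let ?i = "horn_inclusion n k"
  let ?to = "to_copy e e' (horn n k)" and ?from = "from_copy e e' (horn n k)"
  let ?from' = "from_copy e e' (std_simplex n)"
  note i = is_smap_horn_inclusion[of n k]
  have c: "is_smap ?to" "is_smap ?from" "is_smap ?from'"
    using e by (auto intro: is_smap_to_copy is_smap_from_copy)
  have "is_smap (copy_smap e e' ?i)"
    using i e by (simp add: is_smap_copy)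
  from joyal_factorisation[OF J this]
  obtain j p where j: "j \<in> C \<inter> W" and p: "p \<in> F" and jp: "tgt j = src p" "copy_smap e e' ?i = scomp p j"
    by blast
  have jp_src: "src j = copy_sset e e' (horn n k)" "tgt p = copy_sset e e' (std_simplex n)"
    using arg_cong[OF jp(2), of src] arg_cong[OF jp(2), of tgt] by simp_all
  have jpq: "is_smap j" "is_smap p" "is_smap q" "has_lifting j q"
    using j p q joyal_acyclic_cofibration_iff[OF J, of j] joyal_fibration_iff[OF J] by auto
  have "quasi_category (src p)"
    using joyal_fibrant_total_space[OF J p] quasi_category_copy[OF e(2) quasi_category_simplex] jp_src
    by simp
  moreover have "is_smap (scomp j ?to) \<and> src (scomp j ?to) = horn n k \<and> tgt (scomp j ?to) = src p"
    using jpq c jp jp_src by (auto intro: is_smap_scomp)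
  ultimately obtain s where s: "is_smap s" "src s = std_simplex n" "tgt s = src p"
      "scomp s ?i = scomp j ?to"
    using k unfolding quasi_category_def by blast
  have ps: "is_smap (scomp ?from' (scomp p s))"
    using s jpq c jp_src by (auto intro!: is_smap_scomp)
  have "scomp ?from' (scomp p s) = smap_id (std_simplex n)"
  proof (rule simplex_smap_eqI[where k = k])
    have "scomp (scomp ?from' (scomp p s)) ?i = scomp ?from' (scomp p (scomp j ?to))"
      using s i jpq jp_src c by (simp add: scomp_assoc[symmetric] is_smap_scomp)
    also have "\<dots> = scomp (scomp ?from' (copy_smap e e' ?i)) ?to"
      using jpq jp jp_src c by (simp add: scomp_assoc is_smap_scomp)
    also have "\<dots> = scomp (scomp ?i ?from) ?to"
      using from_copy_natural[of ?i e e'] i e by simp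
    also have "\<dots> = scomp (smap_id (std_simplex n)) ?i"
      using c i e by (simp add: scomp_assoc[symmetric] from_to_copy scomp_id_right scomp_id_left)
    finally show "scomp (scomp ?from' (scomp p s)) ?i = scomp (smap_id (std_simplex n)) ?i" .
  qed (use ps s k in \<open>auto simp: is_smap_id is_sset_simplex\<close>)
  note retract = this
  fix u v
  assume u: "is_smap u" "src u = src ?i" "tgt u = src q"
    and v: "is_smap v" "src v = tgt ?i" "tgt v = tgt q" and sq: "scomp q u = scomp v ?i"
  have sq': "scomp q (scomp u ?from) = scomp (scomp v (scomp ?from' p)) j"
  proof -
    have "scomp q (scomp u ?from) = scomp v (scomp ?i ?from)"
      using u v c i sq by (simp add: scomp_assoc)
    also have "\<dots> = scomp v (scomp ?from' (scomp p j))"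
      using from_copy_natural[of ?i e e'] i e jp by simp
    also have "\<dots> = scomp (scomp v (scomp ?from' p)) j"
      using jpq jp jp_src c v by (simp add: scomp_assoc is_smap_scomp)
    finally show ?thesis .
  qed
  obtain l where l: "is_smap l" "src l = src p" "tgt l = src q"
      "scomp l j = scomp u ?from" "scomp q l = scomp v (scomp ?from' p)"
    by (rule has_liftingD[OF jpq(4) _ _ _ _ _ _ sq'])
      (use u v c jpq jp jp_src in \<open>auto intro!: is_smap_scomp\<close>)
  have "scomp (scomp l s) ?i = scomp (scomp l j) ?to"
    using scomp_assoc[of ?i s l] scomp_assoc[of ?to j l] s i jp jp_src c by simp
  also have "\<dots> = u"
    using u c e by (simp add: l(4) scomp_assoc[symmetric] from_to_copy scomp_id_right)
  finally have "scomp (scomp l s) ?i = u" .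
  moreover have "scomp q (scomp l s) = scomp v (scomp ?from' (scomp p s))"
    using scomp_assoc[of s l q] scomp_assoc[of s "scomp ?from' p" v] scomp_assoc[of s p ?from']
      s l jpq jp_src c by (simp add: is_smap_scomp)
  then have "scomp q (scomp l s) = v"
    using v by (simp add: retract scomp_id_right)
  ultimately show "\<exists>h. is_smap h \<and> src h = tgt ?i \<and> tgt h = src q \<and>
      scomp h ?i = u \<and> scomp q h = v"
    using is_smap_scomp[OF s(1) l(1)] s(2,3) l(2,3) by (intro exI[of _ "scomp l s"]) simp
qed

lemma split_monomorphism:
  assumes "is_smap f" "is_smap r" "src r = tgt f" "scomp r f = smap_id (src f)"
  shows "monomorphism f"
  unfolding monomorphism_def
proof (intro conjI allI impI)
  fix g h :: "('a, 'a) smap"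
  assume gh: "is_smap g \<and> is_smap h \<and> src g = src h \<and> tgt g = src f \<and> tgt h = src f \<and>
    scomp f g = scomp f h"
  then have "scomp (scomp r f) g = scomp (scomp r f) h"
    using scomp_assoc[of g f r] scomp_assoc[of h f r] by simp
  then show "g = h"
    using gh assms(4) by (simp add: scomp_id_left)
qed (rule assms)

text \<open>
  The edge \<open>12\<close> is an acyclic cofibration by \<open>has_lifting_short_edge\<close>. Two-out-of-three, applied to the
  common retraction of both edges, makes the edge \<open>02\<close> acyclic as well.
\<close>

lemma long_edge_not_joyal_fibration:
  fixes e :: "(nat \<Rightarrow> nat) \<Rightarrow> 'u"
  assumes J: "joyal_model_structure W C F"
    and e: "encodes e e' (horn 2 1)" "encodes e e' (std_simplex 2)" "encodes e e' (std_simplex 1)"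
      "encodes e e' collapsed_triangle"
  shows "copy_smap e e' long_edge \<notin> F"
proof
  let ?f = "copy_smap e e' long_edge" and ?g = "copy_smap e e' short_edge"
    and ?r = "copy_smap e e' retraction"
  note maps = is_smap_edges is_smap_retraction
  have smaps: "is_smap ?f" "is_smap ?g" "is_smap ?r"
    using e by (simp_all add: is_smap_copy maps)
  have r: "scomp ?r ?f = smap_id (src ?f)" "scomp ?r ?g = smap_id (src ?g)"
    using e by (simp_all add: copy_smap_scomp[symmetric] maps retraction_edges copy_smap_id
        del: One_nat_def)
  have two: "(b \<in> W \<and> scomp a b \<in> W \<longrightarrow> a \<in> W) \<and> (a \<in> W \<and> scomp a b \<in> W \<longrightarrow> b \<in> W)"
    if "is_smap b" "is_smap a" "tgt b = src a" for a b
    using J that unfolding joyal_model_structure_def model_structure_def two_out_of_three_def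
    by blast
  have id: "smap_id X \<in> W" if X: "is_sset X" for X
  proof -
    have "has_lifting (smap_id X) p" if "is_smap p" for p
    proof (rule has_liftingI)
      fix u v assume uv: "is_smap u" "src u = src (smap_id X)" "tgt u = src p"
        "is_smap v" "src v = tgt (smap_id X)" "tgt v = tgt p" "scomp p u = scomp v (smap_id X)"
      then show "\<exists>h. is_smap h \<and> src h = tgt (smap_id X) \<and> tgt h = src p \<and>
          scomp h (smap_id X) = u \<and> scomp p h = v"
        by (intro exI[of _ u]) (simp add: scomp_id_right)
    qed
    then show ?thesis
      using joyal_acyclic_cofibration_iff[OF J, of "smap_id X"] joyal_fibration_iff[OF J] X is_smap_id
      by blast
  qed
  have "has_lifting ?g q" if "q \<in> F" for q
    using joyal_fibration_lifts_horn[OF J that _ _ e(1,2)] that joyal_fibration_iff[OF J] e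
    by (intro has_lifting_copy_left has_lifting_short_edge) (auto simp: maps)
  then have g: "?g \<in> W"
    using joyal_acyclic_cofibration_iff[OF J] smaps by blast
  have "scomp ?r ?g \<in> W" "scomp ?r ?f \<in> W"
    unfolding r using id[OF smap_sset(1)[OF smaps(1)]] id[OF smap_sset(1)[OF smaps(2)]] by simp_all
  moreover have "tgt ?g = src ?r" "tgt ?f = src ?r"
    by simp_all
  ultimately have f: "?f \<in> W"
    using two[OF smaps(2,3)] two[OF smaps(1,3)] g by blast
  have "monomorphism ?f"
    using split_monomorphism[OF smaps(1,3) _ r(1)] by simp
  then have "?f \<in> C"
    using J unfolding joyal_model_structure_def by blast
  moreover assume "?f \<in> F"
  ultimately have lift: "has_lifting ?f ?f"
    using f joyal_acyclic_cofibration_iff[OF J] by blast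
  have sq: "scomp ?f (smap_id (src ?f)) = scomp (smap_id (tgt ?f)) ?f"
    using scomp_id_left[OF smaps(1) refl] scomp_id_right[OF smaps(1) refl] by (simp only:)
  \<comment> \<open>Lifting against itself gives a section, so every simplex of the target is in the image.\<close>
  obtain h where h: "is_smap h" "src h = tgt ?f" "tgt h = src ?f"
      "scomp ?f h = smap_id (tgt ?f)"
    by (rule has_liftingD[OF lift _ _ _ _ _ _ sq])
      (use is_smap_id smap_sset[OF smaps(1)] in \<open>simp_all del: copy_sel\<close>)
  let ?x = "edge 1 2"
  have x: "?x \<in> simp collapsed_triangle 1"
    using edge_delta_maps[of 1 2 2] by (simp add: collapse_def)
  have "fn h 1 (e ?x) \<in> simp (src ?f) 1"
    using smap_in[OF h(1), of "e ?x" 1] h x by (simp del: collapsed_triangle_sel)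
  then obtain \<alpha> where \<alpha>: "fn h 1 (e ?x) = e \<alpha>" "\<alpha> \<in> delta_maps 1 1"
    by auto
  have "e (fn long_edge 1 \<alpha>) = fn ?f 1 (e \<alpha>)"
    using copy_smap_app[OF maps(1), of e e' \<alpha> 1] \<alpha>(2) e by simp
  also have "\<dots> = fn (scomp ?f h) 1 (e ?x)"
    using scomp_sel(3)[of "e ?x" h 1 ?f] h(2) x \<alpha>(1) by (simp del: collapsed_triangle_sel)
  also have "\<dots> = e ?x"
    unfolding h(4) using x by (simp del: collapsed_triangle_sel)
  finally have "e' (e (fn long_edge 1 \<alpha>)) = e' (e ?x)"
    by simp
  moreover have "fn long_edge 1 \<alpha> \<in> simp collapsed_triangle 1"
    using smap_in[OF maps(1), of \<alpha> 1] \<alpha>(2) by (simp del: collapsed_triangle_sel)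
  ultimately have "fn long_edge 1 \<alpha> = ?x"
    using encodesD(2)[OF e(4)] x by metis
  then have "fn long_edge 1 \<alpha> 0 = 1"
    by simp
  moreover have "fn long_edge 1 \<alpha> 0 \<noteq> 1"
    using \<alpha>(2) by (auto simp: edges_app(1) collapse_def simp del: One_nat_def)
  ultimately show False by simp
qed

section \<open>Functors and nerves\<close>

lemma functorD:
  assumes "is_functor C D F"
  shows "is_category C" "is_category D"
    and "fobj F \<in> extensional (Obj C)" "farr F \<in> extensional (Arr C)"
    and "a \<in> Obj C \<Longrightarrow> fobj F a \<in> Obj D" "f \<in> Arr C \<Longrightarrow> farr F f \<in> Arr D"
    and "f \<in> Arr C \<Longrightarrow> Dom D (farr F f) = fobj F (Dom C f)"
    and "f \<in> Arr C \<Longrightarrow> Cod D (farr F f) = fobj F (Cod C f)"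
    and "a \<in> Obj C \<Longrightarrow> farr F (Ident C a) = Ident D (fobj F a)"
    and "f \<in> Arr C \<Longrightarrow> g \<in> Arr C \<Longrightarrow> Cod C f = Dom C g \<Longrightarrow>
           farr F (Comp C g f) = Comp D (farr F g) (farr F f)"
  using assms unfolding is_functor_def PiE_def by blast+

lemma categoryD:
  assumes "is_category C"
  shows "f \<in> Arr C \<Longrightarrow> Dom C f \<in> Obj C" "f \<in> Arr C \<Longrightarrow> Cod C f \<in> Obj C"
    and "a \<in> Obj C \<Longrightarrow> Ident C a \<in> Arr C"
    and "a \<in> Obj C \<Longrightarrow> Dom C (Ident C a) = a" "a \<in> Obj C \<Longrightarrow> Cod C (Ident C a) = a"
    and "f \<in> Arr C \<Longrightarrow> g \<in> Arr C \<Longrightarrow> Cod C f = Dom C g \<Longrightarrow> Comp C g f \<in> Arr C"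
    and "f \<in> Arr C \<Longrightarrow> g \<in> Arr C \<Longrightarrow> Cod C f = Dom C g \<Longrightarrow> Dom C (Comp C g f) = Dom C f"
    and "f \<in> Arr C \<Longrightarrow> g \<in> Arr C \<Longrightarrow> Cod C f = Dom C g \<Longrightarrow> Cod C (Comp C g f) = Cod C g"
    and "f \<in> Arr C \<Longrightarrow> Comp C f (Ident C (Dom C f)) = f"
    and "f \<in> Arr C \<Longrightarrow> Comp C (Ident C (Cod C f)) f = f"
    and "f \<in> Arr C \<Longrightarrow> g \<in> Arr C \<Longrightarrow> h \<in> Arr C \<Longrightarrow> Cod C f = Dom C g \<Longrightarrow> Cod C g = Dom C h \<Longrightarrow>
           Comp C h (Comp C g f) = Comp C (Comp C h g) f"
  using assms unfolding is_category_def by blast+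

lemma functorI:
  assumes "is_category C" "is_category D"
    and "fobj F \<in> extensional (Obj C)" "farr F \<in> extensional (Arr C)"
    and "\<And>a. a \<in> Obj C \<Longrightarrow> fobj F a \<in> Obj D" "\<And>f. f \<in> Arr C \<Longrightarrow> farr F f \<in> Arr D"
    and "\<And>f. f \<in> Arr C \<Longrightarrow> Dom D (farr F f) = fobj F (Dom C f)"
    and "\<And>f. f \<in> Arr C \<Longrightarrow> Cod D (farr F f) = fobj F (Cod C f)"
    and "\<And>a. a \<in> Obj C \<Longrightarrow> farr F (Ident C a) = Ident D (fobj F a)"
    and "\<And>f g. f \<in> Arr C \<Longrightarrow> g \<in> Arr C \<Longrightarrow> Cod C f = Dom C g \<Longrightarrow>
           farr F (Comp C g f) = Comp D (farr F g) (farr F f)"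
  shows "is_functor C D F"
  using assms unfolding is_functor_def PiE_def by blast

lemma fctr_eqI:
  fixes F G :: "('o, 'm, 'p, 'n) fctr"
  assumes "is_functor C D F" "is_functor C D G"
    and "\<And>a. a \<in> Obj C \<Longrightarrow> fobj F a = fobj G a" "\<And>f. f \<in> Arr C \<Longrightarrow> farr F f = farr G f"
  shows "F = G"
proof -
  have "fobj F = fobj G" "farr F = farr G"
    using functorD(3,4)[OF assms(1)] functorD(3,4)[OF assms(2)] assms(3,4)
    by (blast intro: extensionalityI)+
  then show ?thesis by (cases F, cases G) simp
qed

lemma functor_eq_arrI:
  assumes F: "is_functor C D F" and G: "is_functor C D G"
    and eq: "\<And>f. f \<in> Arr C \<Longrightarrow> farr F f = farr G f"
  shows "F = G"
proof (rule fctr_eqI[OF F G])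
  fix a assume a: "a \<in> Obj C"
  note C = categoryD[OF functorD(1)[OF F]]
  have "Dom D (farr F (Ident C a)) = Dom D (farr G (Ident C a))"
    using eq C(3)[OF a] by simp
  then show "fobj F a = fobj G a"
    using functorD(7)[OF F C(3)[OF a]] functorD(7)[OF G C(3)[OF a]] C(4)[OF a] by simp
qed (rule eq)

lemma fctr_comp_sel [simp]:
  "a \<in> Obj C \<Longrightarrow> fobj (fctr_comp C G F) a = fobj G (fobj F a)"
  "f \<in> Arr C \<Longrightarrow> farr (fctr_comp C G F) f = farr G (farr F f)"
  by (simp_all add: fctr_comp_def compose_def)

lemma is_functor_comp:
  assumes F: "is_functor A B F" and G: "is_functor B C G"
  shows "is_functor A C (fctr_comp A G F)"
proof (rule functorI)
  show "is_category A" "is_category C"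
    using functorD(1)[OF F] functorD(2)[OF G] by auto
  show "fobj (fctr_comp A G F) \<in> extensional (Obj A)" "farr (fctr_comp A G F) \<in> extensional (Arr A)"
    by (simp_all add: fctr_comp_def)
qed (use categoryD[OF functorD(1)[OF F]] functorD(5-)[OF F] functorD(5-)[OF G] in simp_all)

lemma fctr_comp_assoc:
  assumes "is_functor A B F"
  shows "fctr_comp A H (fctr_comp A G F) = fctr_comp A (fctr_comp B H G) F"
  unfolding fctr_comp_def using functorD(5,6)[OF assms]
  by (auto simp: compose_def fun_eq_iff restrict_def)

definition id_fctr :: "('o, 'm) cat \<Rightarrow> ('o, 'm, 'o, 'm) fctr" where
  "id_fctr C = \<lparr>fobj = restrict id (Obj C), farr = restrict id (Arr C)\<rparr>"

lemma is_functor_id: "is_category C \<Longrightarrow> is_functor C C (id_fctr C)"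
  by (rule functorI) (auto simp: id_fctr_def categoryD)

lemma fctr_comp_id_left:
  assumes F: "is_functor C D F"
  shows "fctr_comp C (id_fctr D) F = F"
  by (rule fctr_eqI[OF is_functor_comp[OF F is_functor_id[OF functorD(2)[OF F]]] F])
    (auto simp: id_fctr_def functorD[OF F])

lemma fctr_comp_id_right:
  assumes F: "is_functor C D F"
  shows "fctr_comp C F (id_fctr C) = F"
  by (rule fctr_eqI[OF is_functor_comp[OF is_functor_id[OF functorD(1)[OF F]] F] F])
    (auto simp: id_fctr_def)

lemma isofibration_id:
  assumes "is_category C"
  shows "isofibration C C (id_fctr C)"
  unfolding isofibration_def
proof (intro conjI ballI allI impI is_functor_id assms)
  fix a v assume "a \<in> Obj C" and v: "is_iso C v \<and> Dom C v = fobj (id_fctr C) a"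
  moreover have "v \<in> Arr C"
    using v by (simp add: is_iso_def)
  ultimately show "\<exists>u. is_iso C u \<and> Dom C u = a \<and> farr (id_fctr C) u = v"
    by (intro exI[of _ v]) (simp add: id_fctr_def)
qed

lemma ordinal_cat_sel [simp]:
  "Obj (ordinal_cat n) = {..n}" "(i, j) \<in> Arr (ordinal_cat n) \<longleftrightarrow> i \<le> j \<and> j \<le> n"
  "Dom (ordinal_cat n) = fst" "Cod (ordinal_cat n) = snd"
  "Ident (ordinal_cat n) i = (i, i)" "Comp (ordinal_cat n) g f = (fst f, snd g)"
  by (simp_all add: ordinal_cat_def)

lemma is_category_ordinal: "is_category (ordinal_cat n)"
  unfolding is_category_def by auto

lemma ordinal_functor_sel [simp]:
  "i \<le> m \<Longrightarrow> fobj (ordinal_functor m \<alpha>) i = \<alpha> i"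
  "i \<le> j \<Longrightarrow> j \<le> m \<Longrightarrow> farr (ordinal_functor m \<alpha>) (i, j) = (\<alpha> i, \<alpha> j)"
  by (simp_all add: ordinal_functor_def)

lemma is_functor_ordinal:
  assumes "\<alpha> \<in> delta_maps m n"
  shows "is_functor (ordinal_cat m) (ordinal_cat n) (ordinal_functor m \<alpha>)"
proof (rule functorI)
  show "fobj (ordinal_functor m \<alpha>) \<in> extensional (Obj (ordinal_cat m))"
    "farr (ordinal_functor m \<alpha>) \<in> extensional (Arr (ordinal_cat m))"
    by (simp_all add: ordinal_functor_def)
qed (use delta_mapsD(1,2)[OF assms] in \<open>auto simp: is_category_ordinal\<close>)

lemma ordinal_functor_id: "ordinal_functor n (restrict id {..n}) = id_fctr (ordinal_cat n)"
  by (rule fctr_eqI[OF is_functor_ordinal[OF id_delta_maps] is_functor_id[OF is_category_ordinal]])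
    (auto simp: id_fctr_def)

lemma ordinal_functor_compose:
  assumes \<alpha>: "\<alpha> \<in> delta_maps m n" and \<beta>: "\<beta> \<in> delta_maps l m"
  shows "ordinal_functor l (compose {..l} \<alpha> \<beta>)
    = fctr_comp (ordinal_cat l) (ordinal_functor m \<alpha>) (ordinal_functor l \<beta>)"
  by (rule fctr_eqI[OF is_functor_ordinal[OF delta_maps_compose[OF \<alpha> \<beta>]]
        is_functor_comp[OF is_functor_ordinal[OF \<beta>] is_functor_ordinal[OF \<alpha>]]])
    (use delta_mapsD(1,2)[OF \<beta>] in auto)

lemma nerve_sel [simp]:
  "\<sigma> \<in> simp (nerve C) n \<longleftrightarrow> is_functor (ordinal_cat n) C \<sigma>"
  "act (nerve C) m n \<alpha> \<sigma> = fctr_comp (ordinal_cat m) \<sigma> (ordinal_functor m \<alpha>)"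
  by (simp_all add: nerve_def)

lemma is_sset_nerve: "is_sset (nerve C)"
proof (rule is_ssetI)
  show "act (nerve C) m n \<alpha> x \<in> simp (nerve C) m"
    if "\<alpha> \<in> delta_maps m n" "x \<in> simp (nerve C) n" for m n \<alpha> x
    using that is_functor_comp[OF is_functor_ordinal] by simp
  show "act (nerve C) n n (restrict id {..n}) x = x" if "x \<in> simp (nerve C) n" for n x
    using that by (simp add: ordinal_functor_id fctr_comp_id_right)
  show "act (nerve C) l n (compose {..l} \<alpha> \<beta>) x = act (nerve C) l m \<beta> (act (nerve C) m n \<alpha> x)"
    if "\<alpha> \<in> delta_maps m n" "\<beta> \<in> delta_maps l m" for l m n \<alpha> \<beta> x
    using that by (simp add: ordinal_functor_compose fctr_comp_assoc[OF is_functor_ordinal[OF that(2)]])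
qed

lemma nerve_map_sel [simp]:
  "src (nerve_map C D F) = nerve C" "tgt (nerve_map C D F) = nerve D"
  "is_functor (ordinal_cat n) C \<sigma> \<Longrightarrow> fn (nerve_map C D F) n \<sigma> = fctr_comp (ordinal_cat n) F \<sigma>"
  by (simp_all add: nerve_map_def)

lemma nerve_arrow_edge:
  assumes g: "is_smap g" "tgt g = nerve D" and x: "x \<in> simp (src g) n" and ij: "i \<le> j" "j \<le> n"
  shows "farr (fn g n x) (i, j) = farr (fn g 1 (act (src g) 1 n (edge i j) x)) (0, 1)"
  using smap_act[OF g(1) edge_delta_maps[OF ij] x] g(2) by simp

text \<open>
  The arrows of a functor \<open>[n] \<rightarrow> D\<close> are its restrictions along edges \<open>[1] \<rightarrow> [n]\<close>, so by naturality
  maps to a nerve are determined by their values on edges.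
\<close>

lemma nerve_smap_eqI:
  assumes f: "is_smap f" "tgt f = nerve D" and g: "is_smap g" "tgt g = nerve D"
    and src: "src f = src g"
    and eq: "\<And>x. x \<in> simp (src g) 1 \<Longrightarrow> farr (fn f 1 x) (0, 1) = farr (fn g 1 x) (0, 1)"
  shows "f = g"
proof (rule smap_eqI[OF src])
  fix n x assume "x \<in> simp (src f) n"
  then have x: "x \<in> simp (src f) n" "x \<in> simp (src g) n" using src by auto
  show "fn f n x = fn g n x"
  proof (rule functor_eq_arrI)
    show "is_functor (ordinal_cat n) D (fn f n x)" "is_functor (ordinal_cat n) D (fn g n x)"
      using smap_in[OF f(1) x(1)] smap_in[OF g(1) x(2)] f g by simp_all
    fix h assume h: "h \<in> Arr (ordinal_cat n)"
    then obtain i j where ij: "h = (i, j)" "i \<le> j" "j \<le> n"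
      by (cases h) auto
    have "act (src g) 1 n (edge i j) x \<in> simp (src g) 1"
      using act_in[OF smap_sset(1)[OF g(1)] edge_delta_maps[OF ij(2,3)] x(2)] .
    from eq[OF this] show "farr (fn f n x) h = farr (fn g n x) h"
      using nerve_arrow_edge[OF f x(1) ij(2,3)] nerve_arrow_edge[OF g x(2) ij(2,3)] src ij(1) by simp
  qed
qed (use f g smap_ext[OF f(1)] smap_ext[OF g(1)] in auto)

section \<open>Homotopy categories\<close>

definition copy_cat :: "('o \<Rightarrow> 'p) \<Rightarrow> ('m \<Rightarrow> 'n) \<Rightarrow> ('o, 'm) cat \<Rightarrow> ('p, 'n) cat" where
  "copy_cat c d A = \<lparr>Obj = c ` Obj A, Arr = d ` Arr A, Dom = c \<circ> Dom A \<circ> inv d, Cod = c \<circ> Cod A \<circ> inv d,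
     Ident = d \<circ> Ident A \<circ> inv c, Comp = (\<lambda>g f. d (Comp A (inv d g) (inv d f)))\<rparr>"

definition to_copy_cat :: "('o \<Rightarrow> 'p) \<Rightarrow> ('m \<Rightarrow> 'n) \<Rightarrow> ('o, 'm) cat \<Rightarrow> ('o, 'm, 'p, 'n) fctr" where
  "to_copy_cat c d A = \<lparr>fobj = restrict c (Obj A), farr = restrict d (Arr A)\<rparr>"

definition from_copy_cat :: "('o \<Rightarrow> 'p) \<Rightarrow> ('m \<Rightarrow> 'n) \<Rightarrow> ('o, 'm) cat \<Rightarrow> ('p, 'n, 'o, 'm) fctr" where
  "from_copy_cat c d A = \<lparr>fobj = restrict (inv c) (c ` Obj A), farr = restrict (inv d) (d ` Arr A)\<rparr>"

lemma copy_cat_functors: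
  assumes A: "is_category A" and c: "inj c" and d: "inj d"
  shows "is_category (copy_cat c d A)"
    and "is_functor A (copy_cat c d A) (to_copy_cat c d A)"
    and "is_functor (copy_cat c d A) A (from_copy_cat c d A)"
    and "fctr_comp (copy_cat c d A) (to_copy_cat c d A) (from_copy_cat c d A) = id_fctr (copy_cat c d A)"
    and "fctr_comp A (from_copy_cat c d A) (to_copy_cat c d A) = id_fctr A"
proof -
  show cat: "is_category (copy_cat c d A)"
    unfolding is_category_def copy_cat_def
    using c d by (auto simp: categoryD[OF A] inj_eq)
  show to: "is_functor A (copy_cat c d A) (to_copy_cat c d A)"
    by (rule functorI) (use A cat c d in \<open>auto simp: to_copy_cat_def copy_cat_def categoryD[OF A]\<close>)
  show "is_functor (copy_cat c d A) A (from_copy_cat c d A)"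
    by (rule functorI)
      (use A cat c d in \<open>auto simp: from_copy_cat_def copy_cat_def categoryD[OF A] inj_eq\<close>)
  show "fctr_comp (copy_cat c d A) (to_copy_cat c d A) (from_copy_cat c d A) = id_fctr (copy_cat c d A)"
    using c d by (auto simp: fctr_comp_def to_copy_cat_def from_copy_cat_def id_fctr_def copy_cat_def
        compose_def fun_eq_iff restrict_def)
  show "fctr_comp A (from_copy_cat c d A) (to_copy_cat c d A) = id_fctr A"
    using c d by (auto simp: fctr_comp_def to_copy_cat_def from_copy_cat_def id_fctr_def
        compose_def fun_eq_iff restrict_def)
qed

text \<open>
  By the Yoneda lemma a map \<open>\<Delta>\<^sup>n \<rightarrow> nerve D\<close> is a functor \<open>[n] \<rightarrow> D\<close>, so \<open>[n]\<close> itself is the homotopy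
  category of \<open>\<Delta>\<^sup>n\<close>, with the unit given by the identity functor.
\<close>

lemma homotopy_category_simplex:
  fixes e :: "(nat \<Rightarrow> nat) \<Rightarrow> 'u" and c :: "nat \<Rightarrow> 'u" and d :: "nat \<times> nat \<Rightarrow> 'u"
  assumes e: "encodes e e' (std_simplex n)" and c: "inj c" and d: "inj d"
  defines "C \<equiv> copy_cat c d (ordinal_cat n)" and "K \<equiv> to_copy_cat c d (ordinal_cat n)"
  defines "\<eta> \<equiv> scomp (yoneda_map (nerve C) n K) (from_copy e e' (std_simplex n))"
  shows "homotopy_category (copy_sset e e' (std_simplex n)) C \<eta>"
  unfolding homotopy_category_def
proof (intro conjI allI impI)
  let ?X = "copy_sset e e' (std_simplex n)"
  let ?L = "from_copy_cat c d (ordinal_cat n)"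
  note cat = copy_cat_functors[OF is_category_ordinal c d, of n, folded C_def K_def]
  show "is_category C" by (rule cat)
  show smap: "is_smap \<eta>" "src \<eta> = ?X" "tgt \<eta> = nerve C"
    unfolding \<eta>_def using e cat(2)
    by (auto intro!: is_smap_scomp is_smap_yoneda_map is_smap_from_copy is_sset_nerve)
  have \<eta>: "fn \<eta> m (e \<alpha>) = fctr_comp (ordinal_cat m) K (ordinal_functor m \<alpha>)"
    if "\<alpha> \<in> delta_maps m n" for m \<alpha>
    using that e by (simp add: \<eta>_def)
  fix D :: "('u, 'u) cat" and g
  assume "is_category D \<and> is_smap g \<and> src g = ?X \<and> tgt g = nerve D"
  then have D: "is_category D" and g: "is_smap g" "src g = ?X" "tgt g = nerve D" by auto
  let ?id = "restrict id {..n}"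
  define G where "G = fn g n (e ?id)"
  have e_id: "e ?id \<in> simp (src g) n"
    using g id_delta_maps by simp
  have G: "is_functor (ordinal_cat n) D G"
    using smap_in[OF g(1) e_id] g by (simp add: G_def)
  have g_app: "fn g m (e \<alpha>) = fctr_comp (ordinal_cat m) G (ordinal_functor m \<alpha>)"
    if "\<alpha> \<in> delta_maps m n" for m \<alpha>
    using smap_act[OF g(1) that e_id] g that encodesD(2)[OF e, of ?id n]
    by (simp add: G_def id_compose_delta id_delta_maps)
  show "\<exists>!F. is_functor C D F \<and> scomp (nerve_map C D F) \<eta> = g"
  proof (rule ex1I)
    let ?F = "fctr_comp C G ?L"
    have "scomp (nerve_map C D ?F) \<eta> = g"
    proof (rule smap_eqI)
      fix m x assume "x \<in> simp (src (scomp (nerve_map C D ?F) \<eta>)) m"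
      then obtain \<alpha> where \<alpha>: "x = e \<alpha>" "\<alpha> \<in> delta_maps m n"
        using smap by auto
      let ?\<alpha> = "ordinal_functor m \<alpha>"
      have "fctr_comp (ordinal_cat m) ?F (fctr_comp (ordinal_cat m) K ?\<alpha>)
          = fctr_comp (ordinal_cat m) (fctr_comp (ordinal_cat n) ?F K) ?\<alpha>"
        by (rule fctr_comp_assoc[OF is_functor_ordinal[OF \<alpha>(2)]])
      also have "fctr_comp (ordinal_cat n) ?F K = G"
        using fctr_comp_assoc[OF cat(2), of G ?L] cat(5) fctr_comp_id_right[OF G] by simp
      finally show "fn (scomp (nerve_map C D ?F) \<eta>) m x = fn g m x"
        using \<alpha> smap is_functor_comp[OF is_functor_ordinal[OF \<alpha>(2)] cat(2)] by (simp add: \<eta> g_app)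
    qed (use smap g scomp_ext[of "nerve_map C D ?F" \<eta>] smap_ext[OF g(1)] in auto)
    then show "is_functor C D ?F \<and> scomp (nerve_map C D ?F) \<eta> = g"
      using is_functor_comp[OF cat(3) G] by simp
  next
    fix F assume "is_functor C D F \<and> scomp (nerve_map C D F) \<eta> = g"
    then have F: "is_functor C D F" "scomp (nerve_map C D F) \<eta> = g" by auto
    have "fn \<eta> n (e ?id) = K"
      using \<eta>[OF id_delta_maps] by (simp add: ordinal_functor_id fctr_comp_id_right[OF cat(2)])
    then have "fctr_comp (ordinal_cat n) F K = G"
      using arg_cong[OF F(2), of "\<lambda>s. fn s n (e ?id)"] smap e_id g cat(2) by (simp add: G_def)
    then have "fctr_comp C G ?L = fctr_comp C F (fctr_comp C K ?L)"
      using fctr_comp_assoc[OF cat(3), of F K] by simp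
    then show "F = fctr_comp C G ?L"
      by (simp add: cat(4) fctr_comp_id_right[OF F(1)])
  qed
qed

text \<open>
  Replacing the edge \<open>12\<close> by \<open>02\<close> does not change a map \<open>T \<rightarrow> nerve D\<close>. The triangle \<open>012\<close> is a functor
  \<open>[2] \<rightarrow> D\<close> whose arrow \<open>0 \<rightarrow> 1\<close> is an identity, because the edge \<open>01\<close> is degenerate in \<open>T\<close>. Its arrows
  \<open>0 \<rightarrow> 2\<close> and \<open>1 \<rightarrow> 2\<close> are then equal.
\<close>

lemma nerve_smap_long_edge_retraction:
  assumes g: "is_smap g" "src g = collapsed_triangle" "tgt g = nerve D"
  shows "scomp g (scomp long_edge retraction) = g"
proof (rule nerve_smap_eqI)
  show "is_smap (scomp g (scomp long_edge retraction))"
    using g by (auto intro!: is_smap_scomp is_smap_edges is_smap_retraction)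
  fix x assume "x \<in> simp (src g) 1"
  then have x: "x \<in> simp collapsed_triangle 1" using g by simp
  let ?y = "fn long_edge 1 (fn retraction 1 x)"
  have rx: "fn retraction 1 x \<in> delta_maps 1 1"
    using smap_in[OF is_smap_retraction, of x 1] x by (simp del: collapsed_triangle_sel)
  have y: "?y = collapse 1 (compose {..1} (\<lambda>i. 2 * i) (compose {..1} (\<lambda>i. i - 1) x))"
    using x rx by (simp add: edges_app del: One_nat_def)
  have x2: "x \<in> delta_maps 1 2" "collapse 1 x = x" using x by auto
  have "farr (fn g 1 ?y) (0, 1) = farr (fn g 1 x) (0, 1)"
  proof (cases "x 0 = 1")
    \<comment> \<open>The vertices of the edge are only \<open>0\<close> and \<open>2\<close>, and the retraction onto \<open>02\<close> fixes it.\<close>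
    case False
    have "x i \<noteq> 1" if "i \<le> 1" for i
    proof (cases "x 1 = 2")
      case True
      from that have "i = 0 \<or> i = 1" by linarith
      then show ?thesis using True False by auto
    next
      case xn: False
      then have "x = (\<lambda>_\<in>{..1}. 0)"
        using x2(2) by (simp add: collapse_def)
      then have "x i = 0"
        using that by (metis atMost_iff restrict_apply')
      then show ?thesis by simp
    qed
    then have "2 * (x i - 1) = x i" if "i \<le> 1" for i
    proof -
      have "x i \<noteq> 1" "x i \<le> 2"
        using \<open>\<And>i. i \<le> 1 \<Longrightarrow> x i \<noteq> 1\<close> delta_mapsD(1)[OF x2(1)] that by blast+
      then show ?thesis by presburger
    qed
    then have "compose {..1} (\<lambda>i. 2 * i) (compose {..1} (\<lambda>i. i - 1) x) = x"
      using delta_mapsD(3)[OF x2(1)] by (intro delta_maps_ext[where m = 1]) auto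
    then show ?thesis using y x2(2) by simp
  next
    case True
    have x1: "x 1 = 2"
      using True x2(2) by (auto simp: collapse_def split: if_splits)
    let ?\<sigma> = "restrict id {..2::nat}"
    have \<sigma>: "?\<sigma> \<in> simp (src g) 2"
      using g id_delta_maps[of 2] by (simp add: collapse_def)
    have face: "act (src g) 1 2 (edge i j) ?\<sigma> = collapse 1 (edge i j)" if "i \<le> j" "j \<le> 2" for i j
      using id_compose_delta[OF edge_delta_maps[OF that]] g(2) by simp
    have "x = edge 1 2"
      using True x1 delta_mapsD(3)[OF x2(1)]
      by (intro delta_maps_ext[where m = 1]) (auto simp: edge_def le_Suc_eq)
    then have fx: "act (src g) 1 2 (edge 1 2) ?\<sigma> = x"
      using face[of 1 2] x2(2) by simp
    have "compose {..1} (\<lambda>i. 2 * i) (compose {..1} (\<lambda>i. i - 1) x) = edge 0 2"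
      using True x1 by (intro delta_maps_ext[where m = 1]) (auto simp: edge_def le_Suc_eq)
    then have fy: "act (src g) 1 2 (edge 0 2) ?\<sigma> = ?y"
      using face[of 0 2] y by simp
    let ?G = "fn g 2 ?\<sigma>"
    have G: "is_functor (ordinal_cat 2) D ?G"
      using smap_in[OF g(1) \<sigma>] g(3) by simp
    have "act (src g) 1 2 (edge 0 1) ?\<sigma> = act (src g) 1 2 (edge 0 0) ?\<sigma>"
      using face[of 0 1] face[of 0 0] by (simp add: collapse_def)
    then have "farr ?G (0, 1) = farr ?G (0, 0)"
      using nerve_arrow_edge[OF g(1,3) \<sigma>, of 0 1] nerve_arrow_edge[OF g(1,3) \<sigma>, of 0 0] by simp
    also have "\<dots> = Ident D (fobj ?G 0)"
      using functorD(9)[OF G, of 0] by simp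
    finally have G01: "farr ?G (0, 1) = Ident D (fobj ?G 0)" .
    have "Dom D (farr ?G (1, 2)) = Cod D (farr ?G (0, 1))"
      using functorD(7)[OF G, of "(1, 2)"] functorD(8)[OF G, of "(0, 1)"] by simp
    also have "\<dots> = fobj ?G 0"
      unfolding G01 using categoryD(5)[OF functorD(2)[OF G]] functorD(5)[OF G, of 0] by simp
    finally have "Comp D (farr ?G (1, 2)) (farr ?G (0, 1)) = farr ?G (1, 2)"
      using categoryD(9)[OF functorD(2)[OF G] functorD(6)[OF G, of "(1, 2)"]] G01 by simp
    then have "farr ?G (0, 2) = farr ?G (1, 2)"
      using functorD(10)[OF G, of "(0, 1)" "(1, 2)"] by simp
    then show ?thesis
      using nerve_arrow_edge[OF g(1,3) \<sigma>, of 0 2] nerve_arrow_edge[OF g(1,3) \<sigma>, of 1 2] fx fy by simp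
  qed
  then show "farr (fn (scomp g (scomp long_edge retraction)) 1 x) (0, 1) = farr (fn g 1 x) (0, 1)"
    using x by (simp del: collapsed_triangle_sel)
qed (use g in simp_all)

text \<open>
  If \<open>Y\<close> retracts onto \<open>X\<close> and nerves do not distinguish the idempotent \<open>i \<circ> r\<close> from the identity, then
  restriction along \<open>i\<close> is a bijection from maps \<open>Y \<rightarrow> nerve D\<close> to maps \<open>X \<rightarrow> nerve D\<close>, with inverse
  given by \<open>r\<close>. Both sides are thus represented by the same category.
\<close>

lemma homotopy_category_retract:
  fixes X Y :: "'u sset"
  assumes \<eta>: "homotopy_category X C \<eta>"
    and i: "is_smap i" "src i = X" "tgt i = Y" and r: "is_smap r" "src r = Y" "tgt r = X"
    and ri: "scomp r i = smap_id X"
    and ir: "\<And>(D :: ('u, 'u) cat) g. is_smap g \<Longrightarrow> src g = Y \<Longrightarrow> tgt g = nerve D \<Longrightarrow>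
               scomp g (scomp i r) = g"
  shows "homotopy_category Y C (scomp \<eta> r)"
  unfolding homotopy_category_def
proof (intro conjI allI impI)
  have e: "is_category C" "is_smap \<eta>" "src \<eta> = X" "tgt \<eta> = nerve C"
    using \<eta> by (simp_all add: homotopy_category_def)
  then show "is_category C" "is_smap (scomp \<eta> r)" "src (scomp \<eta> r) = Y" "tgt (scomp \<eta> r) = nerve C"
    using r by (simp_all add: is_smap_scomp)
  have universal: "\<forall>(D :: ('u, 'u) cat) g. is_category D \<and> is_smap g \<and> src g = X \<and> tgt g = nerve D \<longrightarrow>
      (\<exists>!F. is_functor C D F \<and> scomp (nerve_map C D F) \<eta> = g)"
    using \<eta> unfolding homotopy_category_def by (elim conjE)
  fix D :: "('u, 'u) cat" and g
  assume "is_category D \<and> is_smap g \<and> src g = Y \<and> tgt g = nerve D"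
  then have D: "is_category D" and g: "is_smap g" "src g = Y" "tgt g = nerve D" by auto
  have gi: "is_smap (scomp g i)" "src (scomp g i) = X" "tgt (scomp g i) = nerve D"
    using g i by (simp_all add: is_smap_scomp)
  have iff: "scomp (nerve_map C D F) (scomp \<eta> r) = g \<longleftrightarrow> scomp (nerve_map C D F) \<eta> = scomp g i" for F
  proof
    let ?F = "nerve_map C D F"
    assume *: "scomp ?F (scomp \<eta> r) = g"
    have "scomp g i = scomp (scomp ?F (scomp \<eta> r)) i"
      by (simp only: *)
    also have "\<dots> = scomp ?F (scomp (scomp \<eta> r) i)"
      using i r by (intro scomp_assoc[symmetric]) simp_all
    also have "scomp (scomp \<eta> r) i = scomp \<eta> (scomp r i)"
      using i r by (intro scomp_assoc[symmetric]) simp_all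
    finally have "scomp g i = scomp ?F (scomp \<eta> (scomp r i))" .
    then show "scomp ?F \<eta> = scomp g i"
      using scomp_id_right[OF e(2,3)] by (simp add: ri)
  next
    let ?F = "nerve_map C D F"
    assume *: "scomp ?F \<eta> = scomp g i"
    have "scomp ?F (scomp \<eta> r) = scomp (scomp g i) r"
      using scomp_assoc[of r \<eta> ?F] r e * by simp
    also have "\<dots> = scomp g (scomp i r)"
      using scomp_assoc[of r i g] r i by simp
    finally show "scomp ?F (scomp \<eta> r) = g"
      using ir[OF g] by simp
  qed
  show "\<exists>!F. is_functor C D F \<and> scomp (nerve_map C D F) (scomp \<eta> r) = g"
    unfolding iff by (rule universal[rule_format]) (intro conjI D gi)
qed

text \<open>
  The category \<open>[1]\<close> serves as the homotopy category of \<open>\<Delta>\<^sup>1\<close> and, through the retraction, of \<open>T\<close>. With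
  these choices \<open>ho(p)\<close> is the identity functor.
\<close>

lemma isofibration_on_ho_long_edge:
  fixes e :: "(nat \<Rightarrow> nat) \<Rightarrow> 'u"
  assumes e: "encodes e e' (std_simplex 1)" "encodes e e' collapsed_triangle"
    and "infinite (UNIV :: 'u set)"
  shows "isofibration_on_ho (copy_smap e e' long_edge)"
proof -
  let ?f = "copy_smap e e' long_edge" and ?r = "copy_smap e e' retraction"
  note maps = is_smap_edges is_smap_retraction
  have smaps: "is_smap ?f" "is_smap ?r"
    using e by (simp_all add: is_smap_copy maps del: One_nat_def)
  have rf: "scomp ?r ?f = smap_id (src ?f)"
    using e by (simp add: copy_smap_scomp[symmetric] maps retraction_edges copy_smap_id
        del: One_nat_def)
  obtain c :: "nat \<Rightarrow> 'u" where c: "inj c"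
    using infinite_countable_subset[OF assms(3)] by blast
  then have d: "inj (c \<circ> prod_encode)"
    by (simp add: inj_compose inj_prod_encode)
  obtain C and \<eta> :: "('u, (nat, nat \<times> nat, 'u, 'u) fctr) smap"
    where \<eta>: "homotopy_category (src ?f) C \<eta>"
    using homotopy_category_simplex[OF e(1) c d] by simp
  have C: "is_category C" "is_smap \<eta>" "src \<eta> = src ?f" "tgt \<eta> = nerve C"
    using \<eta> by (simp_all add: homotopy_category_def)
  have "scomp g (scomp ?f ?r) = g"
    if g: "is_smap g" "src g = tgt ?f" "tgt g = nerve D" for D :: "('u, 'u) cat" and g
  proof -
    let ?to = "to_copy e e' collapsed_triangle" and ?from = "from_copy e e' collapsed_triangle"
    have to: "is_smap ?to" "is_smap ?from"
      using e by (simp_all add: is_smap_to_copy is_smap_from_copy)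
    have fr: "is_smap (scomp ?f ?r)" "is_smap (scomp long_edge retraction)"
      using smaps maps by (auto intro: is_smap_scomp)
    have "scomp ?f ?r = copy_smap e e' (scomp long_edge retraction)"
      using e maps by (simp add: copy_smap_scomp del: One_nat_def)
    also have "\<dots> = scomp ?to (scomp (scomp long_edge retraction) ?from)"
      by (simp add: copy_smap_def)
    finally have "scomp g (scomp ?f ?r) = scomp g (scomp ?to (scomp (scomp long_edge retraction) ?from))"
      by simp
    also have "\<dots> = scomp (scomp g ?to) (scomp (scomp long_edge retraction) ?from)"
      using to fr by (intro scomp_assoc) (auto intro: is_smap_scomp)
    also have "\<dots> = scomp (scomp (scomp g ?to) (scomp long_edge retraction)) ?from"
      using to fr by (intro scomp_assoc) auto
    also have "scomp (scomp g ?to) (scomp long_edge retraction) = scomp g ?to"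
      using g to by (intro nerve_smap_long_edge_retraction[where D = D]) (auto intro: is_smap_scomp)
    also have "scomp (scomp g ?to) ?from = scomp g (scomp ?to ?from)"
      using to by (simp add: scomp_assoc)
    also have "\<dots> = g"
      using g e by (simp add: to_from_copy scomp_id_right)
    finally show ?thesis .
  qed
  then have \<theta>: "homotopy_category (tgt ?f) C (scomp \<eta> ?r)"
    using smaps rf by (intro homotopy_category_retract[OF \<eta>, of ?f _ ?r]) auto
  have "scomp (nerve_map C C (id_fctr C)) \<eta> = \<eta>"
  proof (rule smap_eqI)
    fix n x assume "x \<in> simp (src (scomp (nerve_map C C (id_fctr C)) \<eta>)) n"
    then have x: "x \<in> simp (src \<eta>) n" by simp
    then have "is_functor (ordinal_cat n) C (fn \<eta> n x)"
      using smap_in[OF C(2) x] C(4) by simp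
    then show "fn (scomp (nerve_map C C (id_fctr C)) \<eta>) n x = fn \<eta> n x"
      using x by (simp add: fctr_comp_id_left)
  qed (use C scomp_ext[of "nerve_map C C (id_fctr C)" \<eta>] smap_ext[OF C(2)] in auto)
  also have "\<dots> = scomp \<eta> (scomp ?r ?f)"
    unfolding rf using C by (simp add: scomp_id_right)
  also have "\<dots> = scomp (scomp \<eta> ?r) ?f"
    using smaps by (simp add: scomp_assoc)
  finally have "scomp (nerve_map C C (id_fctr C)) \<eta> = scomp (scomp \<eta> ?r) ?f" .
  with \<eta> \<theta> is_functor_id[OF C(1)] isofibration_id[OF C(1)] smaps(1) show ?thesis
    unfolding isofibration_on_ho_def
    by (intro conjI exI[of _ C] exI[of _ \<eta>] exI[of _ "scomp \<eta> ?r"] exI[of _ "id_fctr C"])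
qed

section \<open>The counterexample\<close>

text \<open>There are only countably many monotone maps between finite ordinals.\<close>

lemma exists_encoding:
  assumes "infinite (UNIV :: 'u set)"
  shows "\<exists>(e :: (nat \<Rightarrow> nat) \<Rightarrow> 'u) e'. \<forall>X. is_sset X \<longrightarrow> (\<forall>m. \<exists>n. simp X m \<subseteq> delta_maps m n) \<longrightarrow>
           encodes e e' X"
proof -
  let ?A = "\<Union>m n. delta_maps m n"
  have "finite (delta_maps m n)" for m n
  proof (rule finite_subset)
    show "delta_maps m n \<subseteq> {..m} \<rightarrow>\<^sub>E {..n}"
      unfolding delta_maps_def by (rule Collect_restrict)
  qed (simp add: finite_PiE)
  then have A: "countable ?A"
    by (intro countable_UN countable_finite countableI_type)
  obtain c :: "nat \<Rightarrow> 'u" where c: "inj c"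
    using infinite_countable_subset[OF assms] by (elim exE conjE)
  define e where "e = c \<circ> to_nat_on ?A"
  have "inj_on e ?A"
    unfolding e_def by (rule comp_inj_on[OF inj_on_to_nat_on[OF A] inj_on_subset[OF c subset_UNIV]])
  then have inv: "inv_into ?A e (e \<alpha>) = \<alpha>" if "\<alpha> \<in> delta_maps m n" for \<alpha> m n
    by (rule inv_into_f_f) (use that in blast)
  have "encodes e (inv_into ?A e) X"
    if X: "is_sset X" and sub: "\<forall>m. \<exists>n. simp X m \<subseteq> delta_maps m n" for X
    unfolding encodes_def
  proof (intro conjI allI ballI X)
    fix m x assume x: "x \<in> simp X m"
    obtain n where "simp X m \<subseteq> delta_maps m n"
      using sub by blast
    from inv[OF subsetD[OF this x]] show "inv_into ?A e (e x) = x" .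
  qed
  then show ?thesis by blast
qed

theorem corollary6:
  assumes "infinite (UNIV :: 'u set)"
  shows "\<exists>p :: ('u, 'u) smap. is_smap p \<and> inner_fibration p \<and> isofibration_on_ho p \<and>
           (\<forall>W C F. joyal_model_structure W C F \<longrightarrow> p \<notin> F)"
proof -
  obtain e :: "(nat \<Rightarrow> nat) \<Rightarrow> 'u" and e' where enc: "\<forall>X. is_sset X \<longrightarrow>
      (\<forall>m. \<exists>n. simp X m \<subseteq> delta_maps m n) \<longrightarrow> encodes e e' X"
    using exists_encoding[OF assms] by blast
  have e: "encodes e e' (std_simplex n)" "encodes e e' (horn n k)" "encodes e e' collapsed_triangle"
    for n k
    by (rule enc[rule_format], rule is_sset_simplex is_sset_horn is_sset_collapsed_triangle, auto)+
  let ?p = "copy_smap e e' long_edge"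
  have p: "is_smap ?p"
    by (rule is_smap_copy) (simp_all add: e is_smap_edges del: One_nat_def)
  have "has_lifting (horn_inclusion n k) ?p" if "0 < k" "k < n" for n k
    by (rule has_lifting_copy_right[OF is_smap_edges(1) _ _ is_smap_horn_inclusion
          long_edge_lifts_inner_horns[OF that]]) (simp_all add: e del: One_nat_def)
  then have "inner_fibration ?p"
    using p by (simp add: inner_fibration_def)
  then show ?thesis
    using p isofibration_on_ho_long_edge[OF e(1,3) assms]
      long_edge_not_joyal_fibration[OF _ e(2) e(1) e(1) e(3)] by (intro exI[of _ ?p] conjI allI impI)
qed

end
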